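(* Let $k\ge 0$ be an integer, $L=\lceil \frac{k+3}{2}\rceil$, and let $\bm U_h^I(x)$ and $\bm U_h^J(x)$ be $\mathbb R^8$-valued functions whose components are polynomials of degree at most $k$ on each primal cell $I_j$ and on each dual cell $J_{j+\frac12}$, respectively. Assume that the cell averages satisfy $\overline{\bm U}_j^I\in\mathcal G$ and $\overline{\bm U}_{j+\frac12}^J\in\mathcal G$ for all $j$. Suppose that $$\bm U_h^I(\widehat x_{j\pm\frac14}^{\nu})\in\mathcal G,\qquad \bm U_h^J(\widehat x_{j\pm\frac14}^{\nu})\in\mathcal G\qquad\forall j,\ 1\le\nu\le L,$$ and that there is a constant $B_{const}$ such that the discrete divergence-free constraint $$(B_1)^J_{j\pm\frac12}=B_{const}=(B_1)^I_{j+\frac12\pm\frac12}\qquad\forall j$$ holds. Then $$\overline{\bm U}_j^I+\Delta t\,\mathcal L_j^I(\bm U_h^I,\bm U_h^J)\in\mathcal G,\qquad \overline{\bm U}_{j+\frac12}^J+\Delta t\,\mathcal L_{j+\frac12}^J(\bm U_h^J,\bm U_h^I)\in\mathcal G\qquad\forall j$$ under the CFL condition $$0<\Delta t\le\frac{\theta\,\widehat\omega_1}{2}\,\Delta x,\qquad \theta=\frac{\Delta t}{\tau_{\max}}\in(0,1].$$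
   Context: **RMHD.** States are $\bm U=(D,\bm m,\bm B,E)^\top\in\mathbb R^8$ with $\bm m=(m_1,m_2,m_3)$, $\bm B=(B_1,B_2,B_3)$. They are related to primitive variables $(\rho,\bm v,\bm B,p)$, $\bm v=(v_1,v_2,v_3)$, by $D=\rho W$, $m_i=\rho hW^2v_i+|\bm B|^2v_i-(\bm v\cdot\bm B)B_i$, $E=\rho hW^2-p_{tot}+|\bm B|^2$, where $W=(1-|\bm v|^2)^{-1/2}$, $p_{tot}=p+p_m$, $p_m=\frac12\big((1-|\bm v|^2)|\bm B|^2+(\bm v\cdot\bm B)^2\big)$ (speed of light $=1$). The specific enthalpy $h=h(p,\rho)=1+e(p,\rho)+p/\rho$ is a given differentiable equation of state with $h(p,\rho)\ge\sqrt{1+p^2/\rho^2}+p/\rho$ and $h\big(\frac1\rho-\frac{\partial h}{\partial p}\big)<\frac{\partial h}{\partial\rho}<0$. The flux is $\bm F_i(\bm U)=\big(Dv_i,\ v_i\bm m-B_i(W^{-2}\bm B+(\bm v\cdot\bm B)\bm v)+p_{tot}\bm e_i,\ v_i\bm B-B_i\bm v,\ m_i\big)^\top$, with $\bm e_i$ the $i$th row of the $3\times3$ identity. The admissible set is $\mathcal G=\{\bm U=(D,\bm m,\bm B,E)^\top: D>0,\ p(\bm U)>0,\ |\bm v(\bm U)|<1\}$, where $p(\bm U),\bm v(\bm U)$ are the primitive quantities determined implicitly by $\bm U$ through the relations $D=\rho W$, $m_i=\rho hW^2v_i+|\bm B|^2v_i-(\bm v\cdot\bm B)B_i$ ($i=1,2,3$),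 $E=\rho hW^2-p_{tot}+|\bm B|^2$ with $W=(1-|\bm v|^2)^{-1/2}$, $p_{tot}=p+\frac12\big((1-|\bm v|^2)|\bm B|^2+(\bm v\cdot\bm B)^2\big)$ and $h=h(p,\rho)$; i.e. $\mathcal G$ consists of the $\bm U$ arising from primitive variables with $\rho>0$, $p>0$, $|\bm v|<1$ (these primitive variables are then uniquely determined by $\bm U$). **1D overlapping meshes.** Uniform primal mesh $I_j=(x_{j-\frac12},x_{j+\frac12})$ of size $\Delta x$, centers $x_j$; dual mesh $J_{j+\frac12}=(x_j,x_{j+1})$. Boundary issues are disregarded (all referenced cells exist). $x_{j\pm\frac14}=x_j\pm\frac14\Delta x$. $\{\widehat x_{j\pm\frac14}^{\nu}\}_{\nu=1}^L$ are the $L$-point Gauss–Lobatto nodes in $[x_{j\pm\frac14}-\frac{\Delta x}4,\ x_{j\pm\frac14}+\frac{\Delta x}4]$, with weights $\widehat\omega_\nu$ normalized by $\sum_{\nu=1}^L\widehat\omega_\nu=1$. Values at nodes lying on endpoints of these half-cells, where the function may be discontinuous, are the limits from inside the half-cell. Notation: $\bm U^J_{j\pm\frac12}=\bm U_h^J(x_{j\pm\frac12})$, $\bm U^I_{j+\frac12\pm\frac12}=\bm U_h^I(x_{j+\frac12\pm\frac12})$, and $(B_1)$ denotes the $B_1$ (fifth) component of such a state. Cell averages: $\overline{\bm U}_j^{\bullet}=\frac1{\Delta x}\int_{I_j}\bm U_h^{\bullet}\,dx$ and $\overline{\bm U}_{j+\frac12}^{\bullet}=\frac1{\Delta x}\int_{J_{j+\frac12}}\bm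 U_h^{\bullet}\,dx$ for $\bullet\in\{I,J\}$. The cell-average operators of the central discontinuous Galerkin (CDG) scheme, with a parameter $\tau_{\max}>0$ (maximum allowed time step), are $$\mathcal L_j^I(\bm U_h^I,\bm U_h^J)=\frac{\overline{\bm U}_j^J-\overline{\bm U}_j^I}{\tau_{\max}}-\frac{\bm F_1(\bm U^J_{j+\frac12})-\bm F_1(\bm U^J_{j-\frac12})}{\Delta x},$$ $$\mathcal L_{j+\frac12}^J(\bm U_h^J,\bm U_h^I)=\frac{\overline{\bm U}_{j+\frac12}^I-\overline{\bm U}_{j+\frac12}^J}{\tau_{\max}}-\frac{\bm F_1(\bm U^I_{j+1})-\bm F_1(\bm U^I_{j})}{\Delta x}.$$
   Formalization: The formal theorem additionally assumes e(p,ρ) → 0 as p → 0+ for each ρ > 0; without it the claim fails, e.g. for h = 1 + 1/(1+ρ) + 4p/ρ, where G is not convex. *)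

theory Defs
  imports "HOL-Analysis.Analysis" "HOL-Computational_Algebra.Polynomial"
begin

type_synonym vec3 = "real^3"

text \<open>A state \<open>(D, m, B, E)\<close>, i.e. a vector of the 8-dimensional Euclidean space
  \<open>real \<times> vec3 \<times> vec3 \<times> real\<close>; the fifth scalar component is the first entry of \<open>B\<close>.\<close>

type_synonym state = "real \<times> vec3 \<times> vec3 \<times> real"

definition dens :: "state \<Rightarrow> real" where "dens U = fst U"
definition mom :: "state \<Rightarrow> vec3" where "mom U = fst (snd U)"
definition mag :: "state \<Rightarrow> vec3" where "mag U = fst (snd (snd U))"

text \<open>The argument order is (pressure, rest-mass density), and the thermodynamic
  domain is \<open>p > 0\<close>, \<open>\<rho> > 0\<close>.\<close>

definition equation_of_state ::
  "(real \<Rightarrow> real \<Rightarrow> real) \<Rightarrow> (real \<Rightarrow> real \<Rightarrow> real) \<Rightarrow> bool" where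
  "equation_of_state e h \<longleftrightarrow> (\<forall>p>0. \<forall>\<rho>>0.
     h p \<rho> = 1 + e p \<rho> + p / \<rho> \<and>
     (\<lambda>(q, r). h q r) differentiable (at (p, \<rho>)) \<and>
     h p \<rho> \<ge> sqrt (1 + p\<^sup>2 / \<rho>\<^sup>2) + p / \<rho> \<and>
     h p \<rho> * (1 / \<rho> - deriv (\<lambda>q. h q \<rho>) p) < deriv (\<lambda>r. h p r) \<rho> \<and>
     deriv (\<lambda>r. h p r) \<rho> < 0)"

text \<open>Cold-matter normalisation of the specific internal energy. It does not follow from
  \<open>equation_of_state\<close>, and the admissible set need not be convex without it: for
  \<open>h p \<rho> = 1 + 1 / (1 + \<rho>) + 4 * p / \<rho>\<close> the admissible states with \<open>m = B = 0\<close> are those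
  with \<open>D > 0\<close> and \<open>E > D + D / (1 + D)\<close>, whose lower boundary is strictly concave in \<open>D\<close>.\<close>

definition vanishes_at_zero_pressure :: "(real \<Rightarrow> real \<Rightarrow> real) \<Rightarrow> bool" where
  "vanishes_at_zero_pressure e \<longleftrightarrow> (\<forall>\<rho>>0. ((\<lambda>p. e p \<rho>) \<longlongrightarrow> 0) (at_right 0))"

definition lorentz :: "vec3 \<Rightarrow> real" where
  "lorentz v = 1 / sqrt (1 - (norm v)\<^sup>2)"

definition p_mag :: "vec3 \<Rightarrow> vec3 \<Rightarrow> real" where
  "p_mag v B = ((1 - (norm v)\<^sup>2) * (norm B)\<^sup>2 + (v \<bullet> B)\<^sup>2) / 2"

definition p_tot :: "vec3 \<Rightarrow> vec3 \<Rightarrow> real \<Rightarrow> real" where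
  "p_tot v B p = p + p_mag v B"

definition conserved ::
  "(real \<Rightarrow> real \<Rightarrow> real) \<Rightarrow> real \<Rightarrow> vec3 \<Rightarrow> vec3 \<Rightarrow> real \<Rightarrow> state" where
  "conserved h \<rho> v B p =
     (let W = lorentz v; H = \<rho> * h p \<rho> * W\<^sup>2 in
      (\<rho> * W,
       H *\<^sub>R v + (norm B)\<^sup>2 *\<^sub>R v - (v \<bullet> B) *\<^sub>R B,
       B,
       H - p_tot v B p + (norm B)\<^sup>2))"

definition is_primitive ::
  "(real \<Rightarrow> real \<Rightarrow> real) \<Rightarrow> state \<Rightarrow> real \<times> vec3 \<times> real \<Rightarrow> bool" where
  "is_primitive h U = (\<lambda>(\<rho>, v, p).
     \<rho> > 0 \<and> p > 0 \<and> norm v < 1 \<and> conserved h \<rho> v (mag U) p = U)"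

definition admissible :: "(real \<Rightarrow> real \<Rightarrow> real) \<Rightarrow> state set" where
  "admissible h = {U. \<exists>w. is_primitive h U w}"

text \<open>\<open>(\<rho>, v, p)\<close> as a function of the conserved state. The choice is arbitrary outside the
  admissible set; on it, the primitive variables are uniquely determined.\<close>

definition primitive :: "(real \<Rightarrow> real \<Rightarrow> real) \<Rightarrow> state \<Rightarrow> real \<times> vec3 \<times> real" where
  "primitive h U = (SOME w. is_primitive h U w)"

definition flux :: "(real \<Rightarrow> real \<Rightarrow> real) \<Rightarrow> 3 \<Rightarrow> state \<Rightarrow> state" where
  "flux h i U =
     (let (\<rho>, v, p) = primitive h U; D = dens U; m = mom U; B = mag U; W = lorentz v in
      (D * v $ i,
       v $ i *\<^sub>R m - B $ i *\<^sub>R ((1 / W\<^sup>2) *\<^sub>R B + (v \<bullet> B) *\<^sub>R v) + p_tot v B p *\<^sub>R axis i 1,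
       v $ i *\<^sub>R B - B $ i *\<^sub>R v,
       m $ i))"

text \<open>\<open>grid x0 dx r\<close> is $x_r$, with a fractional index \<open>r\<close>. Accordingly
  \<open>cell x0 dx r\<close> is the primal cell $I_r$ for integer \<open>r\<close> and the dual cell $J_r$ for
  half-integer \<open>r\<close>. The meshes are indexed by all integers, so there are no boundary cells.\<close>

definition grid :: "real \<Rightarrow> real \<Rightarrow> real \<Rightarrow> real" where
  "grid x0 dx r = x0 + r * dx"

definition cell :: "real \<Rightarrow> real \<Rightarrow> real \<Rightarrow> real set" where
  "cell x0 dx r = {grid x0 dx (r - 1/2) <..< grid x0 dx (r + 1/2)}"

definition poly_on :: "nat \<Rightarrow> real set \<Rightarrow> (real \<Rightarrow> state) \<Rightarrow> bool" where
  "poly_on k S U \<longleftrightarrow>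
     (\<forall>b\<in>Basis. \<exists>q :: real poly. degree q \<le> k \<and> (\<forall>x\<in>S. U x \<bullet> b = poly q x))"

definition cell_avg :: "real \<Rightarrow> real \<Rightarrow> (real \<Rightarrow> state) \<Rightarrow> real \<Rightarrow> state" where
  "cell_avg x0 dx U r = (1 / dx) *\<^sub>R integral (cell x0 dx r) U"

text \<open>Cell-average operator on the cell with index \<open>r\<close>, for the mesh carrying \<open>U\<close>; \<open>V\<close> is the
  solution on the other mesh, whose cells are centred at the endpoints of that cell.
  Integer \<open>r\<close> with \<open>(U, V) = (U\<^sup>I, U\<^sup>J)\<close> gives the primal operator, half-integer \<open>r\<close> with
  \<open>(U, V) = (U\<^sup>J, U\<^sup>I)\<close> the dual one.\<close>

definition cdg_op ::
  "(real \<Rightarrow> real \<Rightarrow> real) \<Rightarrow> real \<Rightarrow> real \<Rightarrow> real \<Rightarrow> (real \<Rightarrow> state) \<Rightarrow> (real \<Rightarrow> state) \<Rightarrow> real \<Rightarrow> state"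
  where
  "cdg_op h x0 dx \<tau> U V r =
     (1 / \<tau>) *\<^sub>R (cell_avg x0 dx V r - cell_avg x0 dx U r)
     - (1 / dx) *\<^sub>R (flux h 1 (V (grid x0 dx (r + 1/2))) - flux h 1 (V (grid x0 dx (r - 1/2))))"

text \<open>Nodes \<open>\<xi> 1 < \<dots> < \<xi> L\<close> and weights \<open>\<omega> 1, \<dots>, \<omega> L\<close> of the \<open>L\<close>-point
  rule on \<open>[-1, 1]\<close>: both endpoints are nodes and the rule has the maximal degree of exactness
  \<open>2 L - 3\<close>, which determines it uniquely. The factor \<open>1/2\<close> normalises the weights to sum 1.\<close>

definition gauss_lobatto :: "nat \<Rightarrow> (nat \<Rightarrow> real) \<Rightarrow> (nat \<Rightarrow> real) \<Rightarrow> bool" where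
  "gauss_lobatto L \<xi> \<omega> \<longleftrightarrow>
     L \<ge> 2 \<and> \<xi> 1 = -1 \<and> \<xi> L = 1 \<and> strict_mono_on {1..L} \<xi> \<and>
     (\<forall>q :: real poly. degree q \<le> 2 * L - 3 \<longrightarrow>
        (\<Sum>\<nu>=1..L. \<omega> \<nu> * poly q (\<xi> \<nu>)) = (1/2) * integral {-1..1} (poly q))"

definition half_cell :: "real \<Rightarrow> real \<Rightarrow> real \<Rightarrow> real set" where
  "half_cell x0 dx s = {grid x0 dx s - dx / 4 <..< grid x0 dx s + dx / 4}"

text \<open>Value at the node of the half-cell centred at $x_s$ with reference coordinate \<open>z\<close> in
  \<open>[-1, 1]\<close>; at an endpoint of the half-cell, the limit from inside.\<close>

definition node_value :: "real \<Rightarrow> real \<Rightarrow> (real \<Rightarrow> state) \<Rightarrow> real \<Rightarrow> real \<Rightarrow> state" where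
  "node_value x0 dx U s z =
     (let y = grid x0 dx s + dx / 4 * z in
      if y \<in> half_cell x0 dx s then U y else Lim (at y within half_cell x0 dx s) U)"

end

theory Submission imports Defs
begin

text \<open>A state \<open>U\<close> with \<open>D > 0\<close> is admissible iff the affine function
  \<open>U \<bullet> normal w C + p_mag w C\<close> of \<open>U\<close> is positive for all \<open>w\<close>, \<open>C\<close> with \<open>norm w < 1\<close>;
  in particular the admissible set is convex. This function is an energy density seen by an
  observer with velocity \<open>w\<close>, and a dominant energy condition says that the corresponding expression in the
  flux cannot exceed it in absolute value, up to a correction that depends on the state only
  through \<open>B\<^sub>1\<close>. Gauss--Lobatto quadrature writes the updated cell average as a
  combination of node values plus the two interface fluxes; each flux is absorbed by the node value
  at the same interface, and the two \<open>B\<^sub>1\<close> terms cancel by the discrete divergence-free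
  constraint.\<close>

section \<open>Energy inequalities for admissible states\<close>

text \<open>\<open>v\<close> and \<open>B\<close> are free parameters here, not the velocity and
  field of a state. The magnetic entry is minus the gradient of \<open>p_mag v\<close> at
  \<open>B\<close>, so adding \<open>p_mag v B\<close> to \<open>U \<bullet> normal v B\<close>
  replaces the quadratic energy term \<open>- p_mag v (mag U)\<close> by its linearisation at
  \<open>B\<close>.\<close>

definition normal :: "vec3 \<Rightarrow> vec3 \<Rightarrow> state" where
  "normal v B = (- sqrt (1 - (norm v)\<^sup>2), - v, - ((1 - (norm v)\<^sup>2) *\<^sub>R B + (v \<bullet> B) *\<^sub>R v), 1)"

section \<open>Quadratic-form estimates for the magnetic field and the fluid\<close>

lemma inner_vec3: "x \<bullet> y = x $ 1 * y $ 1 + x $ 2 * y $ 2 + x $ 3 * y $ 3" for x y :: vec3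
  by (simp add: inner_vec_def sum_3)

text \<open>Cauchy-Schwarz with the unit vector \<open>(v, sqrt (1 - (norm v)\<^sup>2))\<close>; it
  removes the observer velocity from the fluid estimates.\<close>

lemma inner_unit_le:
  fixes a v :: "'a :: real_inner"
  assumes "norm v \<le> 1"
  shows "a \<bullet> v + d * sqrt (1 - (norm v)\<^sup>2) \<le> sqrt ((norm a)\<^sup>2 + d\<^sup>2)"
proof -
  have v: "(norm v)\<^sup>2 \<le> 1" using assms by (simp add: abs_square_le_1)
  have "(a, d) \<bullet> (v, sqrt (1 - (norm v)\<^sup>2)) \<le> norm (a, d) * norm (v, sqrt (1 - (norm v)\<^sup>2))"
    by (rule norm_cauchy_schwarz)
  then show ?thesis using v by (simp add: norm_Pair)
qed

text \<open>This is the Hermitian form of \<open>I + x sigma_3 + y sigma_1 + z sigma_2\<close>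
  (Pauli matrices) at the complex vector \<open>(P + i Q, R + i T)\<close>; the eigenvalues are 1
  plus or minus the length of \<open>(x, y, z)\<close>.\<close>

lemma null_energy_form:
  fixes P Q R T x y z :: real
  assumes "x\<^sup>2 + y\<^sup>2 + z\<^sup>2 \<le> 1"
  shows "0 \<le> (P\<^sup>2 + Q\<^sup>2) * (1 + x) + (R\<^sup>2 + T\<^sup>2) * (1 - x)
             + 2 * y * (P * R + Q * T) + 2 * z * (P * T - Q * R)"
proof -
  define M N where "M = P\<^sup>2 + Q\<^sup>2" and "N = R\<^sup>2 + T\<^sup>2"
  define t where "t = y * (P * R + Q * T) + z * (P * T - Q * R)"
  define S where "S = (M * (1 + x) + N * (1 - x)) / 2"
  have MN: "M \<ge> 0" "N \<ge> 0" by (auto simp: M_def N_def)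
  have "x\<^sup>2 \<le> 1"
    using assms zero_le_power2[of y] zero_le_power2[of z] by linarith
  then have x: "\<bar>x\<bar> \<le> 1" by (simp add: abs_square_le_1)
  have S0: "0 \<le> S" using x MN unfolding S_def by (auto intro!: add_nonneg_nonneg mult_nonneg_nonneg)
  \<comment> \<open>The squared terms are the real and imaginary parts of
    \<open>(y - i z) (P - i Q) (R + i T)\<close>, so the identity is multiplicativity of the
    modulus.\<close>
  have "t\<^sup>2 + (y * (P * T - Q * R) - z * (P * R + Q * T))\<^sup>2 = (y\<^sup>2 + z\<^sup>2) * (M * N)"
    unfolding t_def M_def N_def by algebra
  then have "t\<^sup>2 \<le> (y\<^sup>2 + z\<^sup>2) * (M * N)"
    using zero_le_power2[of "y * (P * T - Q * R) - z * (P * R + Q * T)"] by linarith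
  also have "\<dots> \<le> (1 - x\<^sup>2) * (M * N)"
    using assms MN by (intro mult_right_mono) auto
  also have "\<dots> = S\<^sup>2 - ((M * (1 + x) - N * (1 - x)) / 2)\<^sup>2"
    unfolding S_def by (simp add: field_simps power2_eq_square)
  also have "\<dots> \<le> S\<^sup>2" by simp
  finally have "\<bar>t\<bar> \<le> S" using S0 by (metis abs_le_square_iff abs_of_nonneg)
  then have "0 \<le> S + t" by linarith
  then show ?thesis unfolding t_def S_def M_def N_def by (simp add: field_simps)
qed

text \<open>With \<open>a = B - C\<close> and \<open>c = w \<times> C - v \<times> B\<close> the bounded expression is \<open>T\<^sub>a\<^sub>b k\<^sup>a u\<^sup>b\<close>, where \<open>T\<close> is the
  electromagnetic stress-energy tensor of the magnetic field \<open>a\<close> and the electric field \<open>c\<close>, \<open>k\<close>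
  is a null vector in direction \<open>\<plusminus>e\<^sub>1\<close>, and \<open>u = (1, w)\<close>.\<close>

lemma magnetic_flux_bound:
  fixes v w B C :: vec3 and s :: real
  assumes w: "norm w \<le> 1" and s: "s = 1 \<or> s = -1"
  defines "q \<equiv> (1 - (norm w)\<^sup>2) *\<^sub>R C + (w \<bullet> C) *\<^sub>R w"
    and "M \<equiv> (norm B)\<^sup>2 *\<^sub>R v - (v \<bullet> B) *\<^sub>R B"
  shows "0 \<le> (norm B)\<^sup>2 - p_mag v B - M \<bullet> w - B \<bullet> q + p_mag w C
    + s * (M $ 1 - v $ 1 * (M \<bullet> w) + B $ 1 * ((1 - (norm v)\<^sup>2) * (B \<bullet> w) + (v \<bullet> B) * (v \<bullet> w))
       - p_mag v B * w $ 1 - (v $ 1 *\<^sub>R B - B $ 1 *\<^sub>R v) \<bullet> q + w $ 1 * p_mag w C - B $ 1 * (w \<bullet> C))"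
    (is "0 \<le> ?lhs")
proof -
  \<comment> \<open>These are \<open>a_1\<close>, \<open>s c_1\<close>, \<open>s a_2 - c_3\<close>
    and \<open>s a_3 + c_2\<close>, the only combinations of field components on which the
    contraction with \<open>k\<close> depends.\<close>
  define P Q R T where "P = B$1 - C$1"
    and "Q = s * ((w$2 * C$3 - w$3 * C$2) - (v$2 * B$3 - v$3 * B$2))"
    and "R = s * (B$2 - C$2) - ((w$1 * C$2 - w$2 * C$1) - (v$1 * B$2 - v$2 * B$1))"
    and "T = s * (B$3 - C$3) + ((w$3 * C$1 - w$1 * C$3) - (v$3 * B$1 - v$1 * B$3))"
  have "(s * w$1)\<^sup>2 + (w$2)\<^sup>2 + (w$3)\<^sup>2 = (norm w)\<^sup>2"
    unfolding power2_norm_eq_inner inner_vec3 using s by (auto simp: power2_eq_square)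
  also have "\<dots> \<le> 1" using w by (simp add: abs_square_le_1)
  finally have "0 \<le> (P\<^sup>2 + Q\<^sup>2) * (1 + s * w$1) + (R\<^sup>2 + T\<^sup>2) * (1 - s * w$1)
             + 2 * w$2 * (P * R + Q * T) + 2 * w$3 * (P * T - Q * R)"
    by (rule null_energy_form)
  also have "\<dots> = 2 * ?lhs"
    using s
  proof
    assume s: "s = 1"
    show ?thesis
      unfolding s P_def Q_def R_def T_def q_def M_def p_mag_def power2_norm_eq_inner inner_vec3
        vector_add_component vector_minus_component vector_scaleR_component real_scaleR_def
      by algebra
  next
    assume s: "s = -1"
    show ?thesis
      unfolding s P_def Q_def R_def T_def q_def M_def p_mag_def power2_norm_eq_inner inner_vec3
        vector_add_component vector_minus_component vector_scaleR_component real_scaleR_def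
      by algebra
  qed
  finally show ?thesis by simp
qed

text \<open>Multiplied by \<open>\<rho>\<close>, the enthalpy bound reads \<open>\<rho> * h p \<rho>
  - p \<ge> sqrt (\<rho>\<^sup>2 + p\<^sup>2)\<close>; the first claim drops
  \<open>\<rho>\<^sup>2\<close> under the root, the second squares.\<close>

lemma eos_bounds:
  assumes "equation_of_state e h" "p > 0" "\<rho> > 0"
  shows "2 * p \<le> \<rho> * h p \<rho>"
    and "\<rho>\<^sup>2 \<le> (\<rho> * h p \<rho>)\<^sup>2 - 2 * (\<rho> * h p \<rho>) * p"
proof -
  have h: "h p \<rho> \<ge> sqrt (1 + p\<^sup>2 / \<rho>\<^sup>2) + p / \<rho>"
    using assms unfolding equation_of_state_def by blast
  have "sqrt (1 + p\<^sup>2 / \<rho>\<^sup>2) * \<rho> = sqrt ((1 + p\<^sup>2 / \<rho>\<^sup>2) * \<rho>\<^sup>2)"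
    using assms by (simp add: real_sqrt_mult)
  also have "(1 + p\<^sup>2 / \<rho>\<^sup>2) * \<rho>\<^sup>2 = \<rho>\<^sup>2 + p\<^sup>2" using assms by (simp add: field_simps)
  finally have "sqrt (\<rho>\<^sup>2 + p\<^sup>2) + p = \<rho> * (sqrt (1 + p\<^sup>2 / \<rho>\<^sup>2) + p / \<rho>)"
    using assms by (simp add: distrib_left mult.commute)
  also have "\<dots> \<le> \<rho> * h p \<rho>" using h assms by (intro mult_left_mono) auto
  finally have R: "\<rho> * h p \<rho> - p \<ge> sqrt (\<rho>\<^sup>2 + p\<^sup>2)" by simp
  moreover have "p \<le> sqrt (\<rho>\<^sup>2 + p\<^sup>2)" by (rule real_le_rsqrt) simp
  ultimately show "2 * p \<le> \<rho> * h p \<rho>" by linarith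
  have "\<rho>\<^sup>2 + p\<^sup>2 = (sqrt (\<rho>\<^sup>2 + p\<^sup>2))\<^sup>2" by simp
  also have "\<dots> \<le> (\<rho> * h p \<rho> - p)\<^sup>2" using R by (intro power_mono) auto
  finally show "\<rho>\<^sup>2 \<le> (\<rho> * h p \<rho>)\<^sup>2 - 2 * (\<rho> * h p \<rho>) * p"
    by (simp add: power2_eq_square algebra_simps)
qed

text \<open>Both expressions are affine in the unit vector
  \<open>(w, sqrt (1 - (norm w)\<^sup>2))\<close>, so \<open>inner_unit_le\<close> gives their worst
  case, and squaring leaves a polynomial inequality that the second bound on \<open>R\<close>
  settles.\<close>

lemma hydro_bounds:
  fixes v w :: vec3 and \<rho> p R s :: real
  assumes pos: "\<rho> > 0" "p > 0" and R: "2 * p \<le> R" "\<rho>\<^sup>2 \<le> R\<^sup>2 - 2 * R * p"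
    and v: "norm v < 1" and w: "norm w \<le> 1" and s: "s = 1 \<or> s = -1"
  defines "H \<equiv> R * (lorentz v)\<^sup>2" and "D \<equiv> \<rho> * lorentz v"
  shows "0 < H - p - H * (v \<bullet> w) - D * sqrt (1 - (norm w)\<^sup>2)"
    and "0 \<le> H - p - H * (v \<bullet> w) - D * sqrt (1 - (norm w)\<^sup>2)
      + s * (H * v $ 1 - v $ 1 * (H * (v \<bullet> w)) - p * w $ 1 - D * v $ 1 * sqrt (1 - (norm w)\<^sup>2))"
proof -
  define x where "x = (lorentz v)\<^sup>2"
  have v1: "(norm v)\<^sup>2 < 1" using v by (simp add: abs_square_less_1)
  then have x: "x = 1 / (1 - (norm v)\<^sup>2)" by (simp add: x_def lorentz_def power_divide)
  have nv: "(norm v)\<^sup>2 = 1 - 1 / x" using v1 by (simp add: x)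
  have x1: "1 \<le> x" using v1 by (simp add: x field_simps)
  have H: "H = R * x" and D2: "D\<^sup>2 = \<rho>\<^sup>2 * x"
    by (simp_all add: H_def D_def x_def power_mult_distrib)
  \<comment> \<open>The bound on \<open>R\<close>, scaled by the squared Lorentz factor
    \<open>x\<close>; both claims reduce to it.\<close>
  have HD: "0 \<le> H\<^sup>2 / x - 2 * H * p - D\<^sup>2"
  proof -
    have "H\<^sup>2 / x - 2 * H * p - D\<^sup>2 = x * (R\<^sup>2 - 2 * R * p - \<rho>\<^sup>2)"
      unfolding H D2 using x1 by (simp add: field_simps power2_eq_square)
    then show ?thesis using R x1 by simp
  qed
  have "1 * (2 * p) \<le> x * R" using x1 R pos by (intro mult_mono) auto
  then have Hp: "2 * p \<le> H" by (simp add: H mult.commute)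
  have "(norm (H *\<^sub>R v))\<^sup>2 = H\<^sup>2 - H\<^sup>2 / x"
    by (simp add: power_mult_distrib nv right_diff_distrib)
  then have "(H - p)\<^sup>2 - ((norm (H *\<^sub>R v))\<^sup>2 + D\<^sup>2) = (H\<^sup>2 / x - 2 * H * p - D\<^sup>2) + p\<^sup>2"
    by (simp add: power2_diff)
  then have "(norm (H *\<^sub>R v))\<^sup>2 + D\<^sup>2 < (H - p)\<^sup>2"
    using HD zero_less_power[OF pos(2), of 2] by linarith
  then have "sqrt ((norm (H *\<^sub>R v))\<^sup>2 + D\<^sup>2) < H - p"
    using Hp pos by (intro real_less_lsqrt) auto
  with inner_unit_le[OF w, of "H *\<^sub>R v" D]
  show "0 < H - p - H * (v \<bullet> w) - D * sqrt (1 - (norm w)\<^sup>2)" by simp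

  \<comment> \<open>When \<open>s\<close> times the flux is added, the terms in \<open>H\<close> and
    \<open>D\<close> gain the factor \<open>c\<close>, while the pressure contributes a shift along
    \<open>e_1\<close>; \<open>a\<close> collects what multiplies \<open>w\<close>.\<close>
  define c where "c = 1 + s * v $ 1"
  define a where "a = (c * H) *\<^sub>R v + (p * s) *\<^sub>R axis 1 1"
  have "\<bar>v $ 1\<bar> < 1" using component_le_norm_cart[of v 1] v by linarith
  then have c: "0 < c" using s by (auto simp: c_def)
  have ss: "s\<^sup>2 = 1" using s by auto
  \<comment> \<open>Squaring below needs \<open>p \<le> c * H\<close>. Although \<open>c\<close> may
    be small, \<open>1 / x \<le> c * (1 - s * v $ 1) \<le> 2 * c\<close> and
    \<open>2 * p \<le> R\<close> suffice.\<close>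
  have "(v $ 1)\<^sup>2 \<le> (norm v)\<^sup>2"
    using component_le_norm_cart[of v 1] by (simp add: abs_le_square_iff[symmetric])
  then have "(1 - (norm v)\<^sup>2) \<le> c * (1 - s * v $ 1)"
    using s by (elim disjE) (simp_all add: c_def power2_eq_square algebra_simps)
  also have "\<dots> \<le> c * 2" using c \<open>\<bar>v $ 1\<bar> < 1\<close> s by (intro mult_left_mono) auto
  finally have "1 \<le> (c * 2) * x" using v1 by (simp add: x)
  then have "1 * p \<le> (c * 2 * x) * (R / 2)" using R pos by (intro mult_mono) auto
  then have cHp: "p \<le> c * H" by (simp add: H algebra_simps)
  have na: "(norm a)\<^sup>2 = (c * H)\<^sup>2 * (norm v)\<^sup>2 + 2 * (c * H) * (p * s) * v $ 1 + p\<^sup>2"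
    unfolding a_def power2_norm_eq_inner using ss
    by (simp add: inner_add_left inner_add_right inner_axis inner_axis' power2_eq_square algebra_simps)
  have "(c * H - p)\<^sup>2 - ((norm a)\<^sup>2 + (c * D)\<^sup>2)
      = c\<^sup>2 * H\<^sup>2 / x - 2 * c * H * p * (1 + s * v $ 1) - c\<^sup>2 * D\<^sup>2"
    unfolding na nv using x1 by (simp add: field_simps power2_eq_square)
  also have "\<dots> = c\<^sup>2 * (H\<^sup>2 / x - 2 * H * p - D\<^sup>2)"
    unfolding c_def[symmetric] by (simp add: field_simps power2_eq_square)
  finally have "(norm a)\<^sup>2 + (c * D)\<^sup>2 \<le> (c * H - p)\<^sup>2"
    using HD mult_nonneg_nonneg[OF zero_le_power2[of c] HD] by linarith
  then have "sqrt ((norm a)\<^sup>2 + (c * D)\<^sup>2) \<le> c * H - p"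
    using cHp by (intro real_le_lsqrt) auto
  with inner_unit_le[OF w, of a "c * D"]
  have "a \<bullet> w + c * D * sqrt (1 - (norm w)\<^sup>2) \<le> c * H - p" by linarith
  then show "0 \<le> H - p - H * (v \<bullet> w) - D * sqrt (1 - (norm w)\<^sup>2)
      + s * (H * v $ 1 - v $ 1 * (H * (v \<bullet> w)) - p * w $ 1 - D * v $ 1 * sqrt (1 - (norm w)\<^sup>2))"
    unfolding a_def c_def by (simp add: inner_add_left inner_axis' algebra_simps)
qed

section \<open>Fluid and magnetic estimates combined\<close>

lemma inner_normal:
  "(D, m, B, E) \<bullet> normal w C
     = E - m \<bullet> w - D * sqrt (1 - (norm w)\<^sup>2) - B \<bullet> ((1 - (norm w)\<^sup>2) *\<^sub>R C + (w \<bullet> C) *\<^sub>R w)"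
  by (simp add: normal_def inner_add_right inner_diff_right)

text \<open>Density and flux split into fluid parts \<open>h0\<close>, \<open>h1\<close> and
  magnetic parts \<open>m0\<close>, \<open>m1\<close>. The bounds at \<open>s = 1\<close> and
  \<open>s = -1\<close> say that the flux does not exceed the density in absolute value, which
  covers every \<open>\<bar>s\<bar> \<le> 1\<close>.\<close>

lemma admissible_energy:
  assumes eos: "equation_of_state e h" and U: "U \<in> admissible h" and w: "norm w < 1"
  shows "0 < U \<bullet> normal w C + p_mag w C"
    and "\<bar>s\<bar> \<le> 1 \<Longrightarrow> 0 \<le> U \<bullet> normal w C + p_mag w C
        + s * (flux h 1 U \<bullet> normal w C + w $ 1 * p_mag w C - mag U $ 1 * (w \<bullet> C))"
proof -
  have "is_primitive h U (primitive h U)"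
    using U unfolding admissible_def primitive_def by (auto intro: someI)
  moreover obtain \<rho> v p where pr: "primitive h U = (\<rho>, v, p)" by (metis prod_cases3)
  ultimately have pos: "\<rho> > 0" "p > 0" "norm v < 1" and Ueq: "conserved h \<rho> v (mag U) p = U"
    by (auto simp: is_primitive_def)
  define B where "B = mag U"
  define R H D q M where "R = \<rho> * h p \<rho>" and "H = R * (lorentz v)\<^sup>2" and "D = \<rho> * lorentz v"
    and "q = (1 - (norm w)\<^sup>2) *\<^sub>R C + (w \<bullet> C) *\<^sub>R w"
    and "M = (norm B)\<^sup>2 *\<^sub>R v - (v \<bullet> B) *\<^sub>R B"
  have v1: "(norm v)\<^sup>2 < 1" using pos(3) by (simp add: abs_square_less_1)
  then have W: "1 / (lorentz v)\<^sup>2 = 1 - (norm v)\<^sup>2" by (simp add: lorentz_def power_divide)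
  have U': "U = (D, H *\<^sub>R v + M, B, H - (p + p_mag v B) + (norm B)\<^sup>2)"
    using Ueq unfolding conserved_def p_tot_def Let_def B_def[symmetric]
    by (simp add: R_def H_def D_def M_def mult.commute mult.left_commute add_diff_eq)
  define h0 h1 where "h0 = H - p - H * (v \<bullet> w) - D * sqrt (1 - (norm w)\<^sup>2)"
    and "h1 = H * v $ 1 - v $ 1 * (H * (v \<bullet> w)) - p * w $ 1 - D * v $ 1 * sqrt (1 - (norm w)\<^sup>2)"
  define m0 m1 where "m0 = (norm B)\<^sup>2 - p_mag v B - M \<bullet> w - B \<bullet> q + p_mag w C"
    and "m1 = M $ 1 - v $ 1 * (M \<bullet> w) + B $ 1 * ((1 - (norm v)\<^sup>2) * (B \<bullet> w) + (v \<bullet> B) * (v \<bullet> w))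
       - p_mag v B * w $ 1 - (v $ 1 *\<^sub>R B - B $ 1 *\<^sub>R v) \<bullet> q + w $ 1 * p_mag w C - B $ 1 * (w \<bullet> C)"
  have 0: "U \<bullet> normal w C + p_mag w C = h0 + m0"
    unfolding U' inner_normal q_def[symmetric] h0_def m0_def by (simp add: inner_add_left algebra_simps)
  have 1: "flux h 1 U \<bullet> normal w C + w $ 1 * p_mag w C - mag U $ 1 * (w \<bullet> C) = h1 + m1"
    unfolding flux_def pr Let_def prod.case W p_tot_def B_def[symmetric] inner_normal q_def[symmetric]
      h1_def m1_def
    by (simp add: U' dens_def mom_def inner_add_left inner_diff_left inner_axis' algebra_simps)
  note R = eos_bounds[OF eos pos(2,1), folded R_def]
  have h: "0 < h0" "0 \<le> h0 + h1" "0 \<le> h0 - h1"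
    using hydro_bounds[OF pos(1,2) R pos(3) less_imp_le[OF w], of 1]
      hydro_bounds(2)[OF pos(1,2) R pos(3) less_imp_le[OF w], of "-1"]
    unfolding h0_def h1_def H_def[symmetric] D_def[symmetric] by auto
  have m: "0 \<le> m0 + m1" "0 \<le> m0 - m1"
    using magnetic_flux_bound[OF less_imp_le[OF w], of 1 B v C]
      magnetic_flux_bound[OF less_imp_le[OF w], of "-1" B v C]
    unfolding m0_def m1_def q_def M_def by simp_all
  show "0 < U \<bullet> normal w C + p_mag w C" unfolding 0 using h m by linarith
  assume s: "\<bar>s\<bar> \<le> 1"
  have "\<bar>s * (h1 + m1)\<bar> \<le> 1 * \<bar>h1 + m1\<bar>" unfolding abs_mult using s by (intro mult_right_mono) auto
  also have "\<dots> \<le> h0 + m0" using h m by (simp add: abs_le_iff)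
  finally show "0 \<le> U \<bullet> normal w C + p_mag w C
        + s * (flux h 1 U \<bullet> normal w C + w $ 1 * p_mag w C - mag U $ 1 * (w \<bullet> C))"
    unfolding 0 1 by linarith
qed

text \<open>The condition \<open>D > 0\<close> gets inequalities of the same shape, with zero
  correction, so that one update argument serves both conditions.\<close>

lemma admissible_dens:
  assumes U: "U \<in> admissible h"
  shows "0 < dens U" and "\<bar>s\<bar> \<le> 1 \<Longrightarrow> 0 \<le> dens U + s * dens (flux h 1 U)"
proof -
  have "is_primitive h U (primitive h U)"
    using U unfolding admissible_def primitive_def by (auto intro: someI)
  moreover obtain \<rho> v p where pr: "primitive h U = (\<rho>, v, p)" by (metis prod_cases3)
  ultimately have pos: "\<rho> > 0" "norm v < 1" and Ueq: "conserved h \<rho> v (mag U) p = U"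
    by (auto simp: is_primitive_def)
  have "(norm v)\<^sup>2 < 1" using pos by (simp add: abs_square_less_1)
  then have "0 < \<rho> * lorentz v" using pos by (simp add: lorentz_def)
  also have "\<rho> * lorentz v = dens U"
    by (subst Ueq[symmetric]) (simp add: dens_def conserved_def Let_def)
  finally show D: "0 < dens U" .
  assume s: "\<bar>s\<bar> \<le> 1"
  have "dens (flux h 1 U) = dens U * v $ 1"
    by (simp add: flux_def pr dens_def Let_def)
  moreover have "\<bar>s * (dens U * v $ 1)\<bar> \<le> 1 * (dens U * 1)"
    using s D pos(2) component_le_norm_cart[of v 1] unfolding abs_mult by (intro mult_mono) auto
  ultimately show "0 \<le> dens U + s * dens (flux h 1 U)" by simp
qed

section \<open>Recovery of the primitive variables\<close>

lemma eos_decreasing_density: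
  assumes eos: "equation_of_state e h" and "p > 0" "0 < r" "r \<le> r'"
  shows "h p r' \<le> h p r"
proof (rule DERIV_nonpos_imp_nonincreasing[OF assms(4)])
  fix \<rho> assume "r \<le> \<rho>" "\<rho> \<le> r'"
  then have \<rho>: "\<rho> > 0" using assms by linarith
  have "(\<lambda>(q, r). h q r) differentiable (at (p, \<rho>))"
    using eos \<rho> assms unfolding equation_of_state_def by blast
  then have "((\<lambda>(q, r). h q r) \<circ> (\<lambda>r. (p, r))) differentiable (at \<rho>)"
    by (intro differentiable_chain_at) (auto intro!: derivative_intros simp: differentiable_Pair)
  then have "(\<lambda>r. h p r) differentiable (at \<rho>)" by (simp add: o_def)
  then have "((\<lambda>r. h p r) has_real_derivative deriv (\<lambda>r. h p r) \<rho>) (at \<rho>)"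
    by (simp add: DERIV_deriv_iff_real_differentiable)
  moreover have "deriv (\<lambda>r. h p r) \<rho> \<le> 0"
    using eos \<rho> assms unfolding equation_of_state_def by (meson less_imp_le)
  ultimately show "\<exists>y. ((\<lambda>r. h p r) has_real_derivative y) (at \<rho>) \<and> y \<le> 0" by blast
qed

lemma eos_continuous_on:
  assumes eos: "equation_of_state e h" and "continuous_on S f" "continuous_on S g"
    and "\<And>x. x \<in> S \<Longrightarrow> f x > 0" "\<And>x. x \<in> S \<Longrightarrow> g x > 0"
  shows "continuous_on S (\<lambda>x. h (f x) (g x))"
proof -
  have "continuous_on {z. fst z > 0 \<and> snd z > 0} (\<lambda>(q, r). h q r)"
    using eos unfolding equation_of_state_def
    by (intro continuous_at_imp_continuous_on ballI differentiable_imp_continuous_within) auto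
  then have "continuous_on S ((\<lambda>(q, r). h q r) \<circ> (\<lambda>x. (f x, g x)))"
    using assms by (intro continuous_on_compose continuous_on_Pair) (auto elim: continuous_on_subset)
  then show ?thesis by (simp add: o_def)
qed

lemma eos_cold_limit:
  assumes eos: "equation_of_state e h" and cold: "vanishes_at_zero_pressure e" and r: "r > 0"
  shows "((\<lambda>p. h p r) \<longlongrightarrow> 1) (at_right 0)"
proof -
  have "((\<lambda>p. e p r) \<longlongrightarrow> 0) (at_right 0)"
    using cold r by (auto simp: vanishes_at_zero_pressure_def)
  then have "((\<lambda>p. 1 + e p r + p / r) \<longlongrightarrow> 1 + 0 + 0 / r) (at_right 0)"
    using r by (intro tendsto_intros) auto
  moreover have "\<forall>\<^sub>F p in at_right 0. 1 + e p r + p / r = h p r"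
    using eos r unfolding eventually_at_right_field
    by (intro exI[of _ 1]) (auto simp: equation_of_state_def)
  ultimately show ?thesis by (auto elim: Lim_transform_eventually)
qed

text \<open>For \<open>H > 0\<close> this solves the momentum relation
  \<open>m = (H + (norm B)\<^sup>2) v - (v \<bullet> B) B\<close> for \<open>v\<close>: its inner
  product with \<open>B\<close> first gives
  \<open>v \<bullet> B = (m \<bullet> B) / H\<close>.\<close>

definition vel :: "vec3 \<Rightarrow> vec3 \<Rightarrow> real \<Rightarrow> vec3" where
  "vel m B H = (1 / (H + (norm B)\<^sup>2)) *\<^sub>R (m + ((m \<bullet> B) / H) *\<^sub>R B)"

lemma vel_inner: "H > 0 \<Longrightarrow> vel m B H \<bullet> B = (m \<bullet> B) / H"
proof -
  assume H: "H > 0"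
  then have "H + (norm B)\<^sup>2 > 0" by (simp add: add_pos_nonneg)
  moreover have "m \<bullet> B + (m \<bullet> B) / H * (norm B)\<^sup>2 = (m \<bullet> B) / H * (H + (norm B)\<^sup>2)"
    using H by (simp add: distrib_left)
  ultimately show ?thesis
    by (simp add: vel_def inner_add_left power2_norm_eq_inner[symmetric])
qed

lemma vel_momentum:
  assumes H: "H > 0"
  shows "H *\<^sub>R vel m B H + (norm B)\<^sup>2 *\<^sub>R vel m B H - (vel m B H \<bullet> B) *\<^sub>R B = m"
proof -
  have "H + (norm B)\<^sup>2 > 0" using H by (simp add: add_pos_nonneg)
  then have "(H + (norm B)\<^sup>2) *\<^sub>R vel m B H = m + ((m \<bullet> B) / H) *\<^sub>R B"
    by (simp add: vel_def)
  then show ?thesis unfolding vel_inner[OF H] by (simp add: scaleR_add_left[symmetric])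
qed

text \<open>For positive \<open>H\<close>, this form has \<open>H\<close> only in denominators,
  below nonnegative numerators, so the speed decreases in \<open>H\<close> and decays like
  \<open>1 / H\<close>.\<close>

lemma vel_norm:
  "(norm (vel m B H))\<^sup>2
     = ((norm m)\<^sup>2 + 2 * (m \<bullet> B)\<^sup>2 / H + (m \<bullet> B)\<^sup>2 * (norm B)\<^sup>2 / H\<^sup>2) / (H + (norm B)\<^sup>2)\<^sup>2"
proof -
  have "(norm (m + ((m \<bullet> B) / H) *\<^sub>R B))\<^sup>2
      = (norm m)\<^sup>2 + 2 * (m \<bullet> B)\<^sup>2 / H + (m \<bullet> B)\<^sup>2 * (norm B)\<^sup>2 / H\<^sup>2"
    unfolding power2_norm_eq_inner
    by (simp add: inner_add_left inner_add_right inner_commute power2_eq_square)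
  then show ?thesis by (simp add: vel_def power_divide)
qed

lemma vel_norm_antimono:
  assumes "0 < H" "H \<le> H'"
  shows "(norm (vel m B H'))\<^sup>2 \<le> (norm (vel m B H))\<^sup>2"
proof -
  have pos: "0 < H + (norm B)\<^sup>2" using assms by (simp add: add_pos_nonneg)
  have "2 * (m \<bullet> B)\<^sup>2 / H' \<le> 2 * (m \<bullet> B)\<^sup>2 / H" using assms by (intro divide_left_mono) auto
  moreover have "H\<^sup>2 \<le> H'\<^sup>2" using assms by (intro power_mono) auto
  then have "(m \<bullet> B)\<^sup>2 * (norm B)\<^sup>2 / H'\<^sup>2 \<le> (m \<bullet> B)\<^sup>2 * (norm B)\<^sup>2 / H\<^sup>2"
    using assms by (intro divide_left_mono) auto
  moreover have "(H + (norm B)\<^sup>2)\<^sup>2 \<le> (H' + (norm B)\<^sup>2)\<^sup>2" using assms pos by (intro power_mono) auto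
  ultimately show ?thesis unfolding vel_norm using assms pos
    by (intro frac_le) (auto intro!: add_nonneg_nonneg)
qed

lemma vel_norm_le:
  assumes "1 \<le> H"
  shows "(norm (vel m B H))\<^sup>2 \<le> ((norm m)\<^sup>2 + 2 * (m \<bullet> B)\<^sup>2 + (m \<bullet> B)\<^sup>2 * (norm B)\<^sup>2) / H\<^sup>2"
proof -
  have H2: "1 \<le> H\<^sup>2" using assms by (simp add: one_le_power)
  have "2 * (m \<bullet> B)\<^sup>2 / H \<le> 2 * (m \<bullet> B)\<^sup>2 / 1"
    using assms by (intro divide_left_mono) auto
  moreover have "(m \<bullet> B)\<^sup>2 * (norm B)\<^sup>2 / H\<^sup>2 \<le> (m \<bullet> B)\<^sup>2 * (norm B)\<^sup>2 / 1"
    using H2 by (intro divide_left_mono) auto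
  ultimately have "(norm m)\<^sup>2 + 2 * (m \<bullet> B)\<^sup>2 / H + (m \<bullet> B)\<^sup>2 * (norm B)\<^sup>2 / H\<^sup>2
      \<le> (norm m)\<^sup>2 + 2 * (m \<bullet> B)\<^sup>2 + (m \<bullet> B)\<^sup>2 * (norm B)\<^sup>2" by linarith
  moreover have "H\<^sup>2 \<le> (H + (norm B)\<^sup>2)\<^sup>2" using assms by (intro power_mono) auto
  ultimately show ?thesis unfolding vel_norm using H2
    by (intro frac_le) (auto intro!: add_nonneg_nonneg)
qed

lemma continuous_on_vel: "continuous_on {0<..} (vel m B)"
proof -
  have "H + (norm B)\<^sup>2 \<noteq> 0" if "H > 0" for H using add_pos_nonneg[OF that zero_le_power2[of "norm B"]] by simp
  then show ?thesis unfolding vel_def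
    by (intro continuous_intros) auto
qed

lemma p_mag_le:
  assumes "norm v \<le> 1" shows "p_mag v B \<le> (norm B)\<^sup>2"
proof -
  have "\<bar>v \<bullet> B\<bar> \<le> norm v * norm B" by (rule Cauchy_Schwarz_ineq2)
  then have "(v \<bullet> B)\<^sup>2 \<le> (norm v * norm B)\<^sup>2"
    by (metis abs_ge_zero power2_abs power_mono)
  then have "2 * p_mag v B \<le> (norm B)\<^sup>2" by (simp add: p_mag_def algebra_simps power_mult_distrib)
  then show ?thesis using zero_le_power2[of "norm B"] by linarith
qed


text \<open>In terms of \<open>H = \<rho> h W\<^sup>2\<close> the relations for \<open>D\<close>, \<open>m\<close>, \<open>E\<close> give \<open>v\<close>, \<open>\<rho>\<close> and \<open>p = P(H)\<close>
  explicitly, which leaves the scalar equation \<open>h (P H) (D * r H) = H * r H / D\<close> with \<open>r = 1/W\<close>.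
  The cold state \<open>H0\<close>, where \<open>H = D W\<close>, has \<open>P H0 < 0\<close> by the hypothesis at \<open>w = v H0\<close>; to the
  right of the last point \<open>H1\<close> with \<open>P \<le> 0\<close> the enthalpy is close to \<open>1\<close>, hence below the
  right-hand side, and for large \<open>H\<close> it is above it.\<close>

lemma admissible_if_energy:
  assumes eos: "equation_of_state e h" and cold: "vanishes_at_zero_pressure e"
    and D: "0 < D"
    and pos: "\<And>w. norm w < 1 \<Longrightarrow> 0 < E - m \<bullet> w - D * sqrt (1 - (norm w)\<^sup>2) - p_mag w B"
  shows "(D, m, B, E) \<in> admissible h"
proof -
  define v where "v = vel m B"
  define N where "N H = (norm (v H))\<^sup>2" for H
  define P where "P H = H - p_mag (v H) B + (norm B)\<^sup>2 - E" for H
  \<comment> \<open>\<open>sqrt\<close> is an odd function on the reals, so \<open>r\<close> remains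
    continuous and monotone at positive \<open>H\<close> with \<open>N H > 1\<close>, where it is
    negative; \<open>0 < r H\<close> is equivalent to \<open>norm (v H) < 1\<close>.\<close>
  define r where "r H = sqrt (1 - N H)" for H
  have cv: "continuous_on {0<..} v" unfolding v_def by (rule continuous_on_vel)
  have cN: "continuous_on {0<..} N" unfolding N_def by (intro continuous_intros cv)
  have cr: "continuous_on {0<..} r" unfolding r_def by (intro continuous_intros cN)
  have cP: "continuous_on {0<..} P" unfolding P_def p_mag_def by (intro continuous_intros cv) auto
  have r_mono: "r H \<le> r H'" if "0 < H" "H \<le> H'" for H H'
    using vel_norm_antimono[OF that, of m B] by (simp add: r_def N_def v_def)
  have r_le: "r H \<le> 1" for H by (simp add: r_def N_def)

  define K where "K = (norm m)\<^sup>2 + 2 * (m \<bullet> B)\<^sup>2 + (m \<bullet> B)\<^sup>2 * (norm B)\<^sup>2"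
  \<comment> \<open>\<open>T\<close> meets three demands: at least \<open>1\<close> for
    \<open>vel_norm_le\<close>, at least the left end \<open>D / 2\<close> of the search interval,
    and \<open>T\<^sup>2 \<ge> D\<^sup>2 + K\<close>, which yields
    \<open>T * r T \<ge> D\<close>.\<close>
  define T where "T = 1 + D + K"
  have K: "0 \<le> K" by (simp add: K_def)
  have T: "1 \<le> T" "D / 2 \<le> T" using D K by (simp_all add: T_def)
  have "N T \<le> K / T\<^sup>2" using vel_norm_le[OF T(1), of m B] by (simp add: N_def v_def K_def)
  then have "T\<^sup>2 * N T \<le> K" using T by (simp add: field_simps)
  moreover have "D\<^sup>2 + K \<le> T\<^sup>2"
    using D K by (simp add: T_def power2_eq_square algebra_simps)
  ultimately have "D\<^sup>2 \<le> T\<^sup>2 * (1 - N T)" by (simp add: algebra_simps)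
  then have "sqrt (D\<^sup>2) \<le> sqrt (T\<^sup>2 * (1 - N T))" by (rule real_sqrt_le_mono)
  then have "D \<le> T * r T" using D T by (simp add: r_def real_sqrt_mult)
  moreover have "D / 2 * r (D / 2) \<le> D" using r_le[of "D / 2"] D by (simp add: mult_le_cancel_left)
  moreover have "continuous_on {D / 2..T} (\<lambda>H. H * r H)"
    using D by (intro continuous_intros continuous_on_subset[OF cr]) auto
  ultimately obtain H0 where "D / 2 \<le> H0" and H0D: "H0 * r H0 = D"
    using IVT'[of "\<lambda>H. H * r H" "D / 2" D T] T by blast
  with D have H0: "0 < H0" by simp
  have r0: "0 < r H0" using H0D D H0 by (metis zero_less_mult_pos)
  have nv: "norm (v H) < 1" if "H0 \<le> H" for H
  proof -
    have "0 < r H" using r_mono[OF H0 that] r0 by simp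
    then show ?thesis by (simp add: r_def N_def abs_square_less_1)
  qed
  have r_pos: "0 < r H" if "H0 \<le> H" for H using r_mono[OF H0 that] r0 by simp

  have P0: "P H0 < 0"
  proof -
    have "N H0 = v H0 \<bullet> v H0" by (simp add: N_def power2_norm_eq_inner)
    then have mv: "m \<bullet> v H0 = (H0 + (norm B)\<^sup>2) * N H0 - (v H0 \<bullet> B)\<^sup>2"
      by (subst vel_momentum[OF H0, of m B, symmetric], fold v_def)
        (simp add: inner_add_left inner_diff_left inner_commute power2_eq_square algebra_simps)
    have "D * sqrt (1 - (norm (v H0))\<^sup>2) = H0 * (r H0)\<^sup>2"
      by (simp add: H0D[symmetric] r_def N_def power2_eq_square)
    also have "(r H0)\<^sup>2 = 1 - N H0"
      using r0 by (simp add: r_def)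
    finally have "0 < E - ((H0 + (norm B)\<^sup>2) * N H0 - (v H0 \<bullet> B)\<^sup>2) - H0 * (1 - N H0) - p_mag (v H0) B"
      using pos[OF nv[OF order_refl]] mv by simp
    then show ?thesis unfolding P_def p_mag_def N_def by (simp add: field_simps)
  qed
  have P_ge: "H - E \<le> P H" if "H0 \<le> H" for H
    using p_mag_le[OF less_imp_le[OF nv[OF that]], of B] by (simp add: P_def)

  \<comment> \<open>Beyond \<open>S\<close> the bound \<open>P H \<ge> H - E\<close> makes
    \<open>P\<close> positive, so the maximum of the compact set \<open>Z\<close> is the last point
    with \<open>P \<le> 0\<close>.\<close>
  define S where "S = H0 + \<bar>E\<bar> + 1"
  have S: "H0 < S" by (simp add: S_def)
  define Z where "Z = {H \<in> {H0..S}. P H \<le> 0}"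
  have "closed Z" unfolding Z_def
    using H0 by (intro continuous_closed_preimage_constant[of "{H0..S}"] continuous_on_closed_Collect_le
        continuous_on_subset[OF cP] continuous_intros) auto
  then have "compact Z"
    by (rule compact_Int_closed[OF compact_Icc[of H0 S], THEN back_subst[of compact]])
      (auto simp: Z_def)
  moreover have "H0 \<in> Z" using P0 S by (simp add: Z_def)
  ultimately obtain H1 where H1: "H1 \<in> Z" and max: "\<And>H. H \<in> Z \<Longrightarrow> H \<le> H1"
    using compact_attains_sup[of Z] by blast
  have P_pos: "0 < P H" if "H1 < H" for H
  proof (cases "H \<le> S")
    case True
    then show ?thesis using that max[of H] H1 by (force simp: Z_def)
  next
    case False
    then have "H0 \<le> H" unfolding S_def by linarith
    then show ?thesis using P_ge[of H] False H0 unfolding S_def by linarith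
  qed
  have isP: "isCont P H" if "H0 \<le> H" for H
    using cP H0 that by (simp add: continuous_on_eq_continuous_at)
  \<comment> \<open>If \<open>H1\<close> were \<open>H0\<close>, then \<open>P H0 < 0\<close> would
    persist just to the right, where \<open>P\<close> is positive. Strictness lifts
    \<open>H1 * r H1 / D\<close> above the cold enthalpy \<open>1\<close>.\<close>
  have H01: "H0 < H1"
  proof (rule ccontr)
    assume "\<not> H0 < H1"
    then have [simp]: "H1 = H0" using H1 by (simp add: Z_def)
    have "\<forall>\<^sub>F H in at_right H0. P H < 0"
      using isP[of H0] P0 by (intro order_tendstoD(2)[of P "P H0"])
        (auto simp: isCont_def filterlim_at_split)
    moreover have "\<forall>\<^sub>F H in at_right H0. H0 < H" by (simp add: eventually_at_filter)
    ultimately have "\<forall>\<^sub>F H in at_right H0. False"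
      by eventually_elim (use P_pos in force)
    then show False by simp
  qed
  have r1: "0 < r H1" using r_pos H01 by simp
  have "1 < H1 * r H1 / D"
  proof -
    have "H0 * r H0 < H1 * r H1"
      using H01 r_mono[OF H0, of H1] r0 H0 by (intro mult_less_le_imp_less) auto
    then show ?thesis using D by (simp add: H0D field_simps)
  qed
  then have "\<forall>\<^sub>F p in at_right 0. h p (D * r H1) < H1 * r H1 / D"
    using eos_cold_limit[OF eos cold, of "D * r H1"] D r1 by (intro order_tendstoD(2)) auto
  then obtain d where d: "d > 0" "\<And>p. 0 < p \<Longrightarrow> p < d \<Longrightarrow> h p (D * r H1) < H1 * r H1 / D"
    unfolding eventually_at_right_field by auto
  have "P H1 < d" using H1 d(1) by (simp add: Z_def)
  then have "\<forall>\<^sub>F H in at_right H1. P H < d"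
    using isP[of H1] H01 by (intro order_tendstoD(2)[of P "P H1"])
      (auto simp: isCont_def filterlim_at_split)
  moreover have "\<forall>\<^sub>F H in at_right H1. H1 < H" by (simp add: eventually_at_filter)
  ultimately have "\<forall>\<^sub>F H in at_right H1. P H < d \<and> H1 < H" by eventually_elim simp
  then obtain Ha where Ha: "P Ha < d" "H1 < Ha"
    using eventually_happens'[of "at_right H1"] by auto
  define G where "G H = h (P H) (D * r H) - H * r H / D" for H
  have Ga: "G Ha \<le> 0"
  proof -
    \<comment> \<open>The cold limit holds at a fixed density, here \<open>D * r H1\<close>; the
      actual density is no smaller, and \<open>h\<close> decreases in it.\<close>
    have "h (P Ha) (D * r Ha) \<le> h (P Ha) (D * r H1)"
      using D r1 P_pos Ha r_mono[of H1 Ha] H01 H0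
      by (intro eos_decreasing_density[OF eos]) auto
    also have "\<dots> < H1 * r H1 / D" using d(2) Ha P_pos by simp
    also have "\<dots> \<le> Ha * r Ha / D"
      using Ha r_mono[of H1 Ha] H01 H0 D r1 by (intro divide_right_mono mult_mono) auto
    finally show ?thesis by (simp add: G_def)
  qed
  \<comment> \<open>Chosen so that \<open>Hb \<ge> 2 * E\<close>, hence
    \<open>Hb \<le> 2 * P Hb\<close>, which \<open>eos_bounds\<close> compares with density times
    enthalpy.\<close>
  define Hb where "Hb = Ha + 2 * \<bar>E\<bar>"
  have Hb: "Ha \<le> Hb" "H0 \<le> Hb" "2 * E \<le> Hb" using Ha H01 H0 by (auto simp: Hb_def)
  have Gb: "0 \<le> G Hb"
  proof -
    have rb: "0 < r Hb" by (rule r_pos[OF Hb(2)])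
    have "Hb * r Hb / D * (D * r Hb) = Hb * (r Hb)\<^sup>2" using D by (simp add: power2_eq_square)
    also have "\<dots> \<le> Hb * 1"
      using rb r_le[of Hb] Hb H0 by (intro mult_left_mono) (auto simp: power_le_one)
    also have "\<dots> \<le> 2 * P Hb" using P_ge[OF Hb(2)] Hb(3) by simp
    also have "\<dots> \<le> h (P Hb) (D * r Hb) * (D * r Hb)"
      using eos_bounds(1)[OF eos, of "P Hb" "D * r Hb"] P_pos[of Hb] Hb Ha D rb
      by (simp add: mult.commute)
    finally have "Hb * r Hb / D \<le> h (P Hb) (D * r Hb)"
      by (rule mult_right_le_imp_le) (use D rb in simp)
    then show ?thesis by (simp add: G_def)
  qed
  have sub: "H0 \<le> H" "0 < H" "H1 < H" if "H \<in> {Ha..Hb}" for H using that H0 H01 Ha by auto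
  have "continuous_on {Ha..Hb} G" unfolding G_def
    using sub D r_pos P_pos
    by (intro continuous_intros eos_continuous_on[OF eos] continuous_on_subset[OF cP]
        continuous_on_subset[OF cr]) auto
  then obtain H where H: "H \<in> {Ha..Hb}" "G H = 0"
    using IVT'[of G Ha 0 Hb] Ga Gb Hb(1) by auto
  note sub = sub[OF H(1)]
  have rH: "0 < r H" using r_pos sub by simp
  then have W: "lorentz (v H) = 1 / r H" by (simp add: lorentz_def r_def N_def)
  have hH: "h (P H) (D * r H) = H * r H / D" using H(2) by (simp add: G_def)
  have HH: "D * r H * h (P H) (D * r H) * (lorentz (v H))\<^sup>2 = H"
    using D rH by (simp add: hH W power2_eq_square)
  have "is_primitive h (D, m, B, E) (D * r H, v H, P H)"
    unfolding is_primitive_def prod.case conserved_def Let_def mag_def fst_conv snd_conv HH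
    using D rH P_pos sub nv vel_momentum[OF sub(2), of m B, folded v_def]
    by (simp add: W p_tot_def P_def)
  then show ?thesis unfolding admissible_def by blast
qed

text \<open>For \<open>norm w < 1\<close> the form \<open>p_mag w\<close> is convex and lies above
  its tangents, so the sharpest condition is at \<open>C = B\<close>, the one passed to
  \<open>admissible_if_energy\<close>. Ranging over all \<open>C\<close> makes each condition affine
  in \<open>U\<close>, so the set is an intersection of half-spaces.\<close>

lemma admissible_iff:
  assumes eos: "equation_of_state e h" and cold: "vanishes_at_zero_pressure e"
  shows "U \<in> admissible h \<longleftrightarrow>
    dens U > 0 \<and> (\<forall>w C. norm w < 1 \<longrightarrow> 0 < U \<bullet> normal w C + p_mag w C)"
proof
  assume "U \<in> admissible h"
  then show "dens U > 0 \<and> (\<forall>w C. norm w < 1 \<longrightarrow> 0 < U \<bullet> normal w C + p_mag w C)"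
    using admissible_energy(1)[OF eos] admissible_dens(1) by blast
next
  assume *: "dens U > 0 \<and> (\<forall>w C. norm w < 1 \<longrightarrow> 0 < U \<bullet> normal w C + p_mag w C)"
  obtain D m B E where U: "U = (D, m, B, E)" by (metis prod_cases4)
  show "U \<in> admissible h" unfolding U
  proof (rule admissible_if_energy[OF eos cold])
    show "0 < D" using * by (simp add: U dens_def)
    fix w :: vec3 assume "norm w < 1"
    then have "0 < (D, m, B, E) \<bullet> normal w B + p_mag w B" using * U by blast
    moreover have "B \<bullet> ((1 - (norm w)\<^sup>2) *\<^sub>R B + (w \<bullet> B) *\<^sub>R w) = 2 * p_mag w B"
      unfolding p_mag_def inner_add_right inner_scaleR_right power2_norm_eq_inner
      by (simp add: inner_commute power2_eq_square)
    ultimately show "0 < E - m \<bullet> w - D * sqrt (1 - (norm w)\<^sup>2) - p_mag w B"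
      unfolding inner_normal by simp
  qed
qed

section \<open>Gauss--Lobatto quadrature\<close>

lemma gauss_lobatto_bounds:
  assumes GL: "gauss_lobatto L \<xi> \<omega>" and \<nu>: "\<nu> \<in> {1..L}"
  shows "-1 \<le> \<xi> \<nu>" "\<xi> \<nu> \<le> 1" "\<nu> \<noteq> 1 \<Longrightarrow> -1 < \<xi> \<nu>" "\<nu> \<noteq> L \<Longrightarrow> \<xi> \<nu> < 1"
proof -
  have L: "1 \<in> {1..L}" "L \<in> {1..L}" and m: "strict_mono_on {1..L} \<xi>" and e: "\<xi> 1 = -1" "\<xi> L = 1"
    using GL by (auto simp: gauss_lobatto_def)
  show a: "-1 < \<xi> \<nu>" if "\<nu> \<noteq> 1"
    using strict_mono_onD[OF m L(1) \<nu>] \<nu> that e by auto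
  show b: "\<xi> \<nu> < 1" if "\<nu> \<noteq> L"
    using strict_mono_onD[OF m \<nu> L(2)] \<nu> that e by auto
  show "-1 \<le> \<xi> \<nu>" "\<xi> \<nu> \<le> 1" using a b e by (cases "\<nu> = 1"; cases "\<nu> = L"; force)+
qed

lemma degree_linear_prod_le:
  "degree (\<Prod>\<mu>\<in>A. [:a \<mu>, b:]) \<le> card A" for b :: "'a :: comm_semiring_1"
proof (cases "finite A")
  case True
  have "degree (\<Prod>\<mu>\<in>A. [:a \<mu>, b:]) \<le> (\<Sum>\<mu>\<in>A. degree [:a \<mu>, b:])"
    using degree_prod_sum_le[OF True, of "\<lambda>\<mu>. [:a \<mu>, b:]"] by (simp add: o_def)
  also have "\<dots> \<le> (\<Sum>\<mu>\<in>A. 1)" by (intro sum_mono) simp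
  finally show ?thesis by simp
qed simp

text \<open>The last two claims test exactness on polynomials vanishing at all nodes but those
  concerned; the end weights agree without an appeal to symmetry of the interior nodes.\<close>

lemma gauss_lobatto_weights:
  assumes GL: "gauss_lobatto L \<xi> \<omega>"
  shows "(\<Sum>\<nu>=1..L. \<omega> \<nu>) = 1" and "\<omega> 1 = \<omega> L"
    and "\<nu> \<in> {2..L-1} \<Longrightarrow> 0 \<le> \<omega> \<nu>"
proof -
  have L: "2 \<le> L" "\<xi> 1 = -1" "\<xi> L = 1" "strict_mono_on {1..L} \<xi>"
    using GL by (auto simp: gauss_lobatto_def)
  have exact: "(\<Sum>\<nu>=1..L. \<omega> \<nu> * poly q (\<xi> \<nu>)) = (1/2) * integral {-1..1} (poly q)"
    if "degree q \<le> 2 * L - 3" for q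
    using GL that by (auto simp: gauss_lobatto_def)
  have split: "(\<Sum>\<nu>=1..L. f \<nu>) = f 1 + (f L + (\<Sum>\<nu>\<in>{2..L-1}. f \<nu>))" for f :: "nat \<Rightarrow> real"
  proof -
    have "{1..L} = insert 1 (insert L {2..L-1})" "1 \<notin> insert L {2..L-1}" "L \<notin> {2..L-1}"
      using L by auto
    then show ?thesis by (simp only: sum.insert finite_insert finite_atLeastAtMost not_False_eq_True)
  qed
  have "poly 1 = (\<lambda>_. 1 :: real)" by auto
  then show "(\<Sum>\<nu>=1..L. \<omega> \<nu>) = 1" using exact[of 1] by simp

  define p where "p = (\<Prod>\<mu>\<in>{2..L-1}. [:- \<xi> \<mu>, 1:])"
  define p' where "p' = (\<Prod>\<mu>\<in>{2..L-1}. [:- \<xi> \<mu>, -1:])"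
  have deg: "degree p \<le> L - 2" "degree p' \<le> L - 2"
    using degree_linear_prod_le[of "\<lambda>\<mu>. - \<xi> \<mu>" 1 "{2..L-1}"]
      degree_linear_prod_le[of "\<lambda>\<mu>. - \<xi> \<mu>" "-1" "{2..L-1}"]
    by (simp_all add: p_def p'_def)
  have p': "poly p' x = poly p (- x)" for x by (simp add: p_def p'_def poly_prod)
  have zero: "poly p (\<xi> \<nu>) = 0" if "\<nu> \<in> {2..L-1}" for \<nu>
    using that by (auto simp: p_def poly_prod intro!: prod_zero)
  have "-1 < \<xi> \<mu>" "\<xi> \<mu> < 1" if "\<mu> \<in> {2..L-1}" for \<mu>
    using gauss_lobatto_bounds(3,4)[OF GL, of \<mu>] that by auto
  then have "poly p 1 \<noteq> 0" "poly p (-1) \<noteq> 0"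
    by (fastforce simp: p_def poly_prod)+
  then have pp: "poly p 1 * poly p (-1) \<noteq> 0" by simp
  \<comment> \<open>The product \<open>p(x) p(-x)\<close> is even and vanishes at the interior nodes, so testing against
    \<open>(1 - x) p(x) p(-x)\<close> and \<open>(1 + x) p(x) p(-x)\<close> isolates the two end weights.\<close>
  define q where "q s = [:1, s:] * (p * p')" for s :: real
  have ex: "(\<Sum>\<nu>=1..L. \<omega> \<nu> * poly (q s) (\<xi> \<nu>)) = (1/2) * integral {-1..1} (poly (q s))" for s
  proof (rule exact)
    have "degree (q s) \<le> degree [:1, s:] + degree (p * p')"
      unfolding q_def by (rule degree_mult_le)
    also have "\<dots> \<le> 1 + (degree p + degree p')"
      by (intro add_mono degree_mult_le) simp
    finally show "degree (q s) \<le> 2 * L - 3" using deg L by simp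
  qed
  have reflect: "(\<lambda>x. poly (q (-1)) (- x)) = poly (q 1)"
    by (simp add: q_def p' fun_eq_iff mult.commute)
  have "integral {-1..1} (poly (q (-1))) = integral {-1..1} (poly (q 1))"
    using Henstock_Kurzweil_Integration.integral_reflect_real[where a = "-1" and b = 1 and f = "poly (q (-1))"]
    by (simp only: minus_minus reflect)
  then have "(\<Sum>\<nu>=1..L. \<omega> \<nu> * poly (q (-1)) (\<xi> \<nu>)) = (\<Sum>\<nu>=1..L. \<omega> \<nu> * poly (q 1) (\<xi> \<nu>))"
    by (simp only: ex)
  moreover have "(\<Sum>\<nu>=1..L. \<omega> \<nu> * poly (q (-1)) (\<xi> \<nu>)) = \<omega> 1 * (2 * (poly p 1 * poly p (-1)))"
    unfolding split using L(2,3) by (simp add: q_def p' zero)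
  moreover have "(\<Sum>\<nu>=1..L. \<omega> \<nu> * poly (q 1) (\<xi> \<nu>)) = \<omega> L * (2 * (poly p 1 * poly p (-1)))"
    unfolding split using L(2,3) by (simp add: q_def p' zero)
  ultimately show "\<omega> 1 = \<omega> L" using pp by simp

  assume \<nu>: "\<nu> \<in> {2..L-1}"
  \<comment> \<open>\<open>(1 - x^2) t(x)^2\<close> has degree at most \<open>2 * L - 4\<close>, is
    nonnegative on \<open>[-1, 1]\<close>, and vanishes at every node but
    \<open>\<xi> \<nu>\<close>.\<close>
  define t where "t = (\<Prod>\<mu>\<in>{2..L-1} - {\<nu>}. [:- \<xi> \<mu>, 1:])"
  have "degree t \<le> L - 3"
    using degree_linear_prod_le[of "\<lambda>\<mu>. - \<xi> \<mu>" 1 "{2..L-1} - {\<nu>}"] \<nu> by (simp add: t_def)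
  then have "degree ([:1, 0, -1:] * (t * t)) \<le> 2 + ((L - 3) + (L - 3))"
    by (intro order.trans[OF degree_mult_le] add_mono) auto
  then have "(\<Sum>\<mu>=1..L. \<omega> \<mu> * poly ([:1, 0, -1:] * (t * t)) (\<xi> \<mu>))
      = (1/2) * integral {-1..1} (poly ([:1, 0, -1:] * (t * t)))"
    using \<nu> by (intro exact) auto
  also have "\<dots> \<ge> 0"
  proof -
    have "0 \<le> poly ([:1, 0, -1:] * (t * t)) x" if "x \<in> {-1..1}" for x
    proof -
      have "x\<^sup>2 \<le> 1" using that by (simp add: abs_square_le_1 abs_le_iff)
      then have "0 \<le> (1 - x * x) * (poly t x * poly t x)" by (simp add: power2_eq_square)
      then show ?thesis by (simp add: algebra_simps)
    qed
    then have "0 \<le> integral {-1..1} (poly ([:1, 0, -1:] * (t * t)))"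
      by (intro integral_nonneg integrable_continuous_real continuous_intros) auto
    then show ?thesis by simp
  qed
  also have "(\<Sum>\<mu>=1..L. \<omega> \<mu> * poly ([:1, 0, -1:] * (t * t)) (\<xi> \<mu>))
      = (\<Sum>\<mu>\<in>{\<nu>}. \<omega> \<mu> * poly ([:1, 0, -1:] * (t * t)) (\<xi> \<mu>))"
  proof (rule sum.mono_neutral_right)
    show "\<forall>\<mu>\<in>{1..L} - {\<nu>}. \<omega> \<mu> * poly ([:1, 0, -1:] * (t * t)) (\<xi> \<mu>) = 0"
    proof
      fix \<mu> assume \<mu>: "\<mu> \<in> {1..L} - {\<nu>}"
      then consider "\<mu> = 1" | "\<mu> = L" | "\<mu> \<in> {2..L-1} - {\<nu>}" by force
      then show "\<omega> \<mu> * poly ([:1, 0, -1:] * (t * t)) (\<xi> \<mu>) = 0"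
      proof cases
        case 3
        then have "poly t (\<xi> \<mu>) = 0" by (auto simp: t_def poly_prod intro!: prod_zero)
        then show ?thesis by simp
      qed (use L in auto)
    qed
  qed (use \<nu> in auto)
  finally have "0 \<le> \<omega> \<nu> * ((1 - (\<xi> \<nu>)\<^sup>2) * (poly t (\<xi> \<nu>))\<^sup>2)"
    by (simp add: power2_eq_square algebra_simps)
  moreover have "(\<xi> \<nu>)\<^sup>2 < 1"
  proof -
    have "-1 < \<xi> \<nu>" "\<xi> \<nu> < 1" using gauss_lobatto_bounds(3,4)[OF GL, of \<nu>] \<nu> by auto
    then have "\<bar>\<xi> \<nu>\<bar> < 1" by linarith
    then show ?thesis by (simp add: abs_square_less_1)
  qed
  then have "0 < 1 - (\<xi> \<nu>)\<^sup>2" by simp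
  moreover have "poly t (\<xi> \<nu>) \<noteq> 0"
  proof -
    have "\<xi> \<nu> \<noteq> \<xi> \<mu>" if "\<mu> \<in> {2..L-1} - {\<nu>}" for \<mu>
    proof
      assume "\<xi> \<nu> = \<xi> \<mu>"
      moreover have "\<nu> \<in> {1..L}" "\<mu> \<in> {1..L}" using \<nu> that by auto
      ultimately have "\<nu> = \<mu>" by (rule inj_onD[OF strict_mono_on_imp_inj_on[OF L(4)]])
      with that show False by simp
    qed
    then show ?thesis by (simp add: t_def poly_prod)
  qed
  then have "0 < (poly t (\<xi> \<nu>))\<^sup>2" by simp
  ultimately show "0 \<le> \<omega> \<nu>" by (metis mult_pos_pos zero_le_mult_iff not_less)
qed

section \<open>Piecewise polynomials and exact quadrature of cell averages\<close>

lemma poly_on_extend: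
  assumes "poly_on k S U"
  shows "\<exists>Q. poly_on k UNIV Q \<and> (\<forall>x\<in>S. U x = Q x)"
proof -
  have "\<exists>q. \<forall>b\<in>Basis. degree (q b) \<le> k \<and> (\<forall>x\<in>S. U x \<bullet> b = poly (q b) x)"
    using assms unfolding poly_on_def by (rule bchoice)
  then obtain q where q: "\<forall>b\<in>Basis. degree (q b) \<le> k \<and> (\<forall>x\<in>S. U x \<bullet> b = poly (q b) x)"
    by blast
  define Q where "Q x = (\<Sum>b\<in>Basis. poly (q b) x *\<^sub>R b)" for x
  have Q: "Q x \<bullet> b = poly (q b) x" if "b \<in> Basis" for x b
    unfolding Q_def by (rule inner_sum_left_Basis[OF that])
  have "poly_on k UNIV Q" unfolding poly_on_def using q Q by blast
  moreover have "U x = Q x" if "x \<in> S" for x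
  proof (rule euclidean_eqI)
    fix b :: state assume b: "b \<in> Basis"
    have "U x \<bullet> b = poly (q b) x" using q b that by blast
    then show "U x \<bullet> b = Q x \<bullet> b" unfolding Q[OF b] .
  qed
  ultimately show ?thesis by blast
qed

lemma poly_on_isCont:
  assumes "poly_on k UNIV Q" shows "isCont Q x"
proof (subst continuous_componentwise, intro ballI)
  fix b :: state assume "b \<in> Basis"
  then obtain q where "\<forall>x\<in>UNIV. Q x \<bullet> b = poly q x"
    using assms unfolding poly_on_def by blast
  then have "(\<lambda>x. Q x \<bullet> b) = poly q" by auto
  then show "isCont (\<lambda>x. Q x \<bullet> b) x" by (metis poly_isCont)
qed

text \<open>The substitution \<open>x = c + d * z\<close>; the length \<open>2 * d\<close> appears
  because the weights sum to 1.\<close>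

lemma gauss_lobatto_has_integral:
  assumes GL: "gauss_lobatto L \<xi> \<omega>" and Q: "poly_on k UNIV Q" and k: "k \<le> 2 * L - 3" and d: "d > 0"
  shows "(Q has_integral (2 * d) *\<^sub>R (\<Sum>\<nu>=1..L. \<omega> \<nu> *\<^sub>R Q (c + d * \<xi> \<nu>))) {c - d..c + d}"
proof (subst has_integral_componentwise_iff, intro ballI)
  fix b :: state assume "b \<in> Basis"
  then obtain q where q: "degree q \<le> k" "\<And>x. Q x \<bullet> b = poly q x"
    using Q unfolding poly_on_def by auto
  define I where "I = (\<Sum>\<nu>=1..L. \<omega> \<nu> * poly q (c + d * \<xi> \<nu>))"
  have "degree (pcompose q [:c, d:]) \<le> degree q * degree [:c, d:]" by (rule degree_pcompose_le)
  also have "\<dots> \<le> 2 * L - 3" using q(1) k d by simp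
  finally have "(\<Sum>\<nu>=1..L. \<omega> \<nu> * poly (pcompose q [:c, d:]) (\<xi> \<nu>))
      = (1/2) * integral {-1..1} (poly (pcompose q [:c, d:]))"
    using GL unfolding gauss_lobatto_def by blast
  then have "2 * I = integral {-1..1} (poly (pcompose q [:c, d:]))"
    by (simp add: I_def poly_pcompose mult.commute)
  then have "(poly (pcompose q [:c, d:]) has_integral (2 * I)) {-1..1}"
    by (simp add: has_integral_integrable_integral integrable_continuous_real continuous_intros)
  moreover have "poly (pcompose q [:c, d:]) = (\<lambda>x. poly q (d *\<^sub>R x + c))"
    by (simp add: poly_pcompose fun_eq_iff algebra_simps)
  moreover have eq: "(2 * d * I) /\<^sub>R d ^ DIM(real) = 2 * I" "(c - d - c) /\<^sub>R d = -1" "(c + d - c) /\<^sub>R d = 1"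
    using d by simp_all
  ultimately have "(poly q has_integral (2 * d * I)) (cbox (c - d) (c + d))"
    by (intro has_integral_affinity_iff[OF d, THEN iffD1, of "poly q" c]) (simp only: eq box_real)
  then show "((\<lambda>x. Q x \<bullet> b) has_integral
      ((2 * d) *\<^sub>R (\<Sum>\<nu>=1..L. \<omega> \<nu> *\<^sub>R Q (c + d * \<xi> \<nu>))) \<bullet> b) {c - d..c + d}"
    by (simp add: q(2) inner_sum_left I_def)
qed

text \<open>With \<open>Q\<close> continuous on the whole line, both branches of
  \<open>node_value\<close> become evaluations of \<open>Q\<close>. \<open>S\<close> may exceed the
  half-cell, so that an end of the half-cell interior to \<open>S\<close> also gets the plain value
  of \<open>V\<close>.\<close>

lemma half_cell_extend:
  assumes dx: "dx > 0" and V: "poly_on k S V" and sub: "half_cell x0 dx s \<subseteq> S"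
  shows "\<exists>Q. poly_on k UNIV Q \<and> (\<forall>x\<in>S. V x = Q x) \<and>
    (\<forall>z\<in>{-1..1}. node_value x0 dx V s z = Q (grid x0 dx s + dx / 4 * z))"
proof -
  obtain Q where Q: "poly_on k UNIV Q" "\<forall>x\<in>S. V x = Q x"
    using poly_on_extend[OF V] by blast
  have "node_value x0 dx V s z = Q (grid x0 dx s + dx / 4 * z)" if z: "z \<in> {-1..1}" for z
  proof -
    define y where "y = grid x0 dx s + dx / 4 * z"
    have "dx / 4 * z \<le> dx / 4 * 1" "dx / 4 * (-1) \<le> dx / 4 * z"
      using z dx by (intro mult_left_mono; simp)+
    then have "y \<in> {grid x0 dx s - dx / 4..grid x0 dx s + dx / 4}" by (simp add: y_def)
    then have cl: "y \<in> closure (half_cell x0 dx s)"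
      using dx by (simp add: half_cell_def closure_greaterThanLessThan)
    show ?thesis
    proof (cases "y \<in> half_cell x0 dx s")
      case True
      then show ?thesis unfolding node_value_def y_def[symmetric] Let_def using Q(2) sub by auto
    next
      case False
      then have "y islimpt half_cell x0 dx s" using cl by (simp add: closure_def)
      moreover have "(Q \<longlongrightarrow> Q y) (at y within half_cell x0 dx s)"
        using poly_on_isCont[OF Q(1), of y] by (auto simp: isCont_def intro: tendsto_within_subset)
      then have "(V \<longlongrightarrow> Q y) (at y within half_cell x0 dx s)"
        by (rule Lim_transform_eventually) (use Q(2) sub in \<open>auto simp: eventually_at_filter intro!: always_eventually\<close>)
      ultimately have "Lim (at y within half_cell x0 dx s) V = Q y"
        by (intro tendsto_Lim) (auto simp: trivial_limit_within)
      then show ?thesis unfolding node_value_def y_def[symmetric] Let_def using False by simp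
    qed
  qed
  with Q show ?thesis by blast
qed

lemma half_cell_has_integral:
  assumes GL: "gauss_lobatto L \<xi> \<omega>" and k: "k \<le> 2 * L - 3" and dx: "dx > 0"
    and V: "poly_on k S V" and sub: "half_cell x0 dx s \<subseteq> S"
  shows "(V has_integral (dx / 2) *\<^sub>R (\<Sum>\<nu>=1..L. \<omega> \<nu> *\<^sub>R node_value x0 dx V s (\<xi> \<nu>)))
    {grid x0 dx s - dx / 4..grid x0 dx s + dx / 4}"
proof -
  obtain Q where Q: "poly_on k UNIV Q" "\<forall>x\<in>S. V x = Q x"
    "\<forall>z\<in>{-1..1}. node_value x0 dx V s z = Q (grid x0 dx s + dx / 4 * z)"
    using half_cell_extend[OF dx V sub] by blast
  define a b where "a = grid x0 dx s - dx / 4" and "b = grid x0 dx s + dx / 4"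
  have "(Q has_integral (2 * (dx / 4)) *\<^sub>R
      (\<Sum>\<nu>=1..L. \<omega> \<nu> *\<^sub>R Q (grid x0 dx s + dx / 4 * \<xi> \<nu>))) {a..b}"
    unfolding a_def b_def using dx by (intro gauss_lobatto_has_integral[OF GL Q(1) k]) simp
  also have "(\<Sum>\<nu>=1..L. \<omega> \<nu> *\<^sub>R Q (grid x0 dx s + dx / 4 * \<xi> \<nu>))
      = (\<Sum>\<nu>=1..L. \<omega> \<nu> *\<^sub>R node_value x0 dx V s (\<xi> \<nu>))"
  proof (rule sum.cong[OF refl])
    fix \<nu> assume "\<nu> \<in> {1..L}"
    then have "\<xi> \<nu> \<in> {-1..1}" using gauss_lobatto_bounds(1,2)[OF GL] by simp
    then show "\<omega> \<nu> *\<^sub>R Q (grid x0 dx s + dx / 4 * \<xi> \<nu>) = \<omega> \<nu> *\<^sub>R node_value x0 dx V s (\<xi> \<nu>)"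
      by (simp only: bspec[OF Q(3)])
  qed
  finally have QI: "(Q has_integral (dx / 2) *\<^sub>R (\<Sum>\<nu>=1..L. \<omega> \<nu> *\<^sub>R node_value x0 dx V s (\<xi> \<nu>))) {a..b}"
    by simp
  have VQ: "V x = Q x" if "x \<in> {a..b} - {a, b}" for x
    using that sub by (intro bspec[OF Q(2)]) (auto simp: half_cell_def a_def b_def subset_iff)
  have "(V has_integral (dx / 2) *\<^sub>R (\<Sum>\<nu>=1..L. \<omega> \<nu> *\<^sub>R node_value x0 dx V s (\<xi> \<nu>))) {a..b}"
    by (rule has_integral_spike_finite[of "{a, b}", OF _ VQ QI]) simp
  then show ?thesis unfolding a_def b_def .
qed

text \<open>\<open>V\<close> may jump at the centre of cell \<open>r\<close>, so the quadrature is
  applied to each half. The outer ends are centres of cells of \<open>V\<close>, where the node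
  values are the plain values entering the flux.\<close>

lemma cell_avg_nodes:
  assumes GL: "gauss_lobatto L \<xi> \<omega>" and k: "k \<le> 2 * L - 3" and dx: "dx > 0"
    and V: "poly_on k (cell x0 dx (r - 1/2)) V" "poly_on k (cell x0 dx (r + 1/2)) V"
  shows "cell_avg x0 dx V r = (1/2) *\<^sub>R (\<Sum>\<nu>=1..L.
      \<omega> \<nu> *\<^sub>R (node_value x0 dx V (r - 1/4) (\<xi> \<nu>) + node_value x0 dx V (r + 1/4) (\<xi> \<nu>)))"
    and "node_value x0 dx V (r - 1/4) (\<xi> 1) = V (grid x0 dx (r - 1/2))"
    and "node_value x0 dx V (r + 1/4) (\<xi> L) = V (grid x0 dx (r + 1/2))"
proof -
  have sub: "half_cell x0 dx (r - 1/4) \<subseteq> cell x0 dx (r - 1/2)"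
    "half_cell x0 dx (r + 1/4) \<subseteq> cell x0 dx (r + 1/2)"
    using dx by (auto simp: half_cell_def cell_def grid_def algebra_simps)
  have e: "grid x0 dx (r - 1/4) - dx / 4 = grid x0 dx (r - 1/2)"
    "grid x0 dx (r - 1/4) + dx / 4 = grid x0 dx r"
    "grid x0 dx (r + 1/4) - dx / 4 = grid x0 dx r"
    "grid x0 dx (r + 1/4) + dx / 4 = grid x0 dx (r + 1/2)"
    by (simp_all add: grid_def algebra_simps)
  have le: "grid x0 dx (r - 1/2) \<le> grid x0 dx r" "grid x0 dx r \<le> grid x0 dx (r + 1/2)"
    using dx by (simp_all add: grid_def algebra_simps)
  have "integral {grid x0 dx (r - 1/2)..grid x0 dx (r + 1/2)} V
      = (dx / 2) *\<^sub>R (\<Sum>\<nu>=1..L. \<omega> \<nu> *\<^sub>R node_value x0 dx V (r - 1/4) (\<xi> \<nu>))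
      + (dx / 2) *\<^sub>R (\<Sum>\<nu>=1..L. \<omega> \<nu> *\<^sub>R node_value x0 dx V (r + 1/4) (\<xi> \<nu>))"
    using half_cell_has_integral[OF GL k dx V(1) sub(1)] half_cell_has_integral[OF GL k dx V(2) sub(2)]
    unfolding e by (intro integral_unique has_integral_combine[OF le])
  moreover have "integral (cell x0 dx r) V = integral {grid x0 dx (r - 1/2)..grid x0 dx (r + 1/2)} V"
    unfolding cell_def by (rule integral_open_interval_real[symmetric])
  ultimately show "cell_avg x0 dx V r = (1/2) *\<^sub>R (\<Sum>\<nu>=1..L.
      \<omega> \<nu> *\<^sub>R (node_value x0 dx V (r - 1/4) (\<xi> \<nu>) + node_value x0 dx V (r + 1/4) (\<xi> \<nu>)))"
    using dx by (simp add: cell_avg_def scaleR_add_right sum.distrib)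
  have ends: "\<xi> 1 = -1" "\<xi> L = 1" using GL by (auto simp: gauss_lobatto_def)
  have mem: "grid x0 dx (r - 1/2) \<in> cell x0 dx (r - 1/2)" "grid x0 dx (r + 1/2) \<in> cell x0 dx (r + 1/2)"
    using dx by (simp_all add: cell_def grid_def algebra_simps)
  obtain Q where Q: "\<forall>x\<in>cell x0 dx (r - 1/2). V x = Q x"
    "\<forall>z\<in>{-1..1}. node_value x0 dx V (r - 1/4) z = Q (grid x0 dx (r - 1/4) + dx / 4 * z)"
    using half_cell_extend[OF dx V(1) sub(1)] by blast
  then show "node_value x0 dx V (r - 1/4) (\<xi> 1) = V (grid x0 dx (r - 1/2))"
    unfolding ends using bspec[OF Q(1) mem(1)] bspec[OF Q(2), of "-1"] e by simp
  obtain Q where Q: "\<forall>x\<in>cell x0 dx (r + 1/2). V x = Q x"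
    "\<forall>z\<in>{-1..1}. node_value x0 dx V (r + 1/4) z = Q (grid x0 dx (r + 1/4) + dx / 4 * z)"
    using half_cell_extend[OF dx V(2) sub(2)] by blast
  then show "node_value x0 dx V (r + 1/4) (\<xi> L) = V (grid x0 dx (r + 1/2))"
    unfolding ends using bspec[OF Q(1) mem(2)] bspec[OF Q(2), of "1"] e by simp
qed

section \<open>The update of the cell averages\<close>

text \<open>\<open>l + c\<close> stands for one functional defining admissibility. In the average,
  \<open>X 1\<close> and \<open>Y L\<close> carry weight
  \<open>\<theta> * \<omega> 1 / 2 \<ge> \<mu>\<close> and absorb their fluxes by
  \<open>split\<close>; the \<open>g\<close> terms cancel; \<open>X L\<close> keeps the result
  strictly positive even when \<open>\<theta> = 1\<close>.\<close>

lemma limited_update_pos: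
  fixes l :: "'a :: real_vector \<Rightarrow> real" and F :: "'a \<Rightarrow> 'a" and g :: "'a \<Rightarrow> real"
  assumes l: "linear l"
    and pos: "\<And>U. U \<in> G \<Longrightarrow> 0 < l U + c"
    and split: "\<And>U s. U \<in> G \<Longrightarrow> \<bar>s\<bar> \<le> 1 \<Longrightarrow> 0 \<le> l U + c + s * (l (F U) + g U)"
    and GL: "gauss_lobatto L \<xi> \<omega>"
    and G: "A \<in> G" "\<And>\<nu>. \<nu> \<in> {1..L} \<Longrightarrow> X \<nu> \<in> G \<and> Y \<nu> \<in> G"
    and g: "g (X 1) = g (Y L)"
    and \<theta>: "0 < \<theta>" "\<theta> \<le> 1" and \<mu>: "0 < \<mu>" "\<mu> \<le> \<theta> * \<omega> 1 / 2"
  shows "0 < l (A + \<theta> *\<^sub>R ((1/2) *\<^sub>R (\<Sum>\<nu>=1..L. \<omega> \<nu> *\<^sub>R (X \<nu> + Y \<nu>)) - A)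
      - \<mu> *\<^sub>R (F (Y L) - F (X 1))) + c"
proof -
  define f where "f U = l U + c" for U
  define \<kappa> where "\<kappa> = \<theta> * \<omega> 1 / 2"
  have \<kappa>: "0 < \<kappa>" "\<mu> \<le> \<kappa>" using \<mu> by (auto simp: \<kappa>_def)
  \<comment> \<open>The sign of the end weights comes from the step-size condition
    \<open>0 < \<mu> \<le> \<kappa>\<close>.\<close>
  then have \<omega>1: "0 < \<omega> 1" using \<theta> by (simp add: \<kappa>_def zero_less_mult_iff)
  have L: "2 \<le> L" using GL by (simp add: gauss_lobatto_def)
  note w = gauss_lobatto_weights[OF GL]
  have nonneg: "0 \<le> \<omega> \<nu>" if "\<nu> \<in> {1..L}" for \<nu>
  proof -
    have "\<nu> = 1 \<or> \<nu> = L \<or> \<nu> \<in> {2..L-1}" using that by auto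
    then show ?thesis using w(2,3) \<omega>1 by (elim disjE) auto
  qed
  have fpos: "0 < f U" if "U \<in> G" for U using pos[OF that] by (simp add: f_def)
  have G1: "X 1 \<in> G" "X L \<in> G" "Y L \<in> G" using G(2)[of 1] G(2)[of L] L by auto
  have X: "\<omega> 1 * f (X 1) + \<omega> 1 * f (X L) \<le> (\<Sum>\<nu>=1..L. \<omega> \<nu> * f (X \<nu>))"
  proof -
    have "\<omega> 1 * f (X 1) + \<omega> 1 * f (X L) = (\<Sum>\<nu>\<in>{1, L}. \<omega> \<nu> * f (X \<nu>))"
      using L w(2) by simp
    also have "\<dots> \<le> (\<Sum>\<nu>=1..L. \<omega> \<nu> * f (X \<nu>))"
      using L by (intro sum_mono2 mult_nonneg_nonneg nonneg less_imp_le[OF fpos] conjunct1[OF G(2)]) auto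
    finally show ?thesis .
  qed
  have Y: "\<omega> 1 * f (Y L) \<le> (\<Sum>\<nu>=1..L. \<omega> \<nu> * f (Y \<nu>))"
  proof -
    have "\<omega> 1 * f (Y L) = (\<Sum>\<nu>\<in>{L}. \<omega> \<nu> * f (Y \<nu>))"
      using w(2) by simp
    also have "\<dots> \<le> (\<Sum>\<nu>=1..L. \<omega> \<nu> * f (Y \<nu>))"
      using L by (intro sum_mono2 mult_nonneg_nonneg nonneg less_imp_le[OF fpos] conjunct2[OF G(2)]) auto
    finally show ?thesis .
  qed
  \<comment> \<open>The flux is added at \<open>X 1\<close> and subtracted at \<open>Y L\<close>,
    hence the two signs; dividing by \<open>\<kappa>\<close> brings \<open>\<mu>\<close> into the
    range of \<open>split\<close>.\<close>
  have s: "\<bar>\<mu> / \<kappa>\<bar> \<le> 1" "\<bar>- (\<mu> / \<kappa>)\<bar> \<le> 1" using \<kappa> \<mu> by auto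
  have "0 \<le> \<kappa> * (f (X 1) + \<mu> / \<kappa> * (l (F (X 1)) + g (X 1)))"
    using split[OF G1(1) s(1)] \<kappa> by (simp add: f_def)
  then have 1: "0 \<le> \<kappa> * f (X 1) + \<mu> * (l (F (X 1)) + g (X 1))"
    using \<kappa> by (simp add: distrib_left)
  have "0 \<le> \<kappa> * (f (Y L) + - (\<mu> / \<kappa>) * (l (F (Y L)) + g (Y L)))"
    using split[OF G1(3) s(2)] \<kappa> by (simp add: f_def)
  then have 2: "0 \<le> \<kappa> * f (Y L) - \<mu> * (l (F (Y L)) + g (Y L))"
    using \<kappa> by (simp add: right_diff_distrib)
  have avg: "(\<Sum>\<nu>=1..L. \<omega> \<nu> * f (X \<nu>)) + (\<Sum>\<nu>=1..L. \<omega> \<nu> * f (Y \<nu>))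
      = l (\<Sum>\<nu>=1..L. \<omega> \<nu> *\<^sub>R (X \<nu> + Y \<nu>)) + 2 * c"
  proof -
    have "(\<Sum>\<nu>=1..L. \<omega> \<nu> * f (X \<nu>)) + (\<Sum>\<nu>=1..L. \<omega> \<nu> * f (Y \<nu>))
      = (\<Sum>\<nu>=1..L. \<omega> \<nu> * l (X \<nu> + Y \<nu>)) + 2 * c * (\<Sum>\<nu>=1..L. \<omega> \<nu>)"
      unfolding sum_distrib_left sum.distrib[symmetric] f_def linear_add[OF l]
      by (intro sum.cong) (auto simp: algebra_simps)
    also have "(\<Sum>\<nu>=1..L. \<omega> \<nu> * l (X \<nu> + Y \<nu>)) = l (\<Sum>\<nu>=1..L. \<omega> \<nu> *\<^sub>R (X \<nu> + Y \<nu>))"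
      by (simp add: linear_sum[OF l] linear_scale[OF l])
    finally show ?thesis using w(1) by simp
  qed
  have "l (A + \<theta> *\<^sub>R ((1/2) *\<^sub>R (\<Sum>\<nu>=1..L. \<omega> \<nu> *\<^sub>R (X \<nu> + Y \<nu>)) - A) - \<mu> *\<^sub>R (F (Y L) - F (X 1))) + c
      = (1 - \<theta>) * f A + \<theta> / 2 * (l (\<Sum>\<nu>=1..L. \<omega> \<nu> *\<^sub>R (X \<nu> + Y \<nu>)) + 2 * c)
        - \<mu> * (l (F (Y L)) - l (F (X 1)))"
    by (simp only: linear_add[OF l] linear_diff[OF l] linear_scale[OF l] f_def real_scaleR_def)
      (simp add: field_simps)
  also have "\<dots> \<ge> \<theta> / 2 * (\<omega> 1 * f (X 1) + \<omega> 1 * f (X L) + \<omega> 1 * f (Y L))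
        - \<mu> * (l (F (Y L)) - l (F (X 1)))"
  proof -
    have "0 \<le> (1 - \<theta>) * f A" using \<theta> fpos[OF G(1)] by simp
    moreover have "\<theta> / 2 * (\<omega> 1 * f (X 1) + \<omega> 1 * f (X L) + \<omega> 1 * f (Y L))
        \<le> \<theta> / 2 * (l (\<Sum>\<nu>=1..L. \<omega> \<nu> *\<^sub>R (X \<nu> + Y \<nu>)) + 2 * c)"
      unfolding avg[symmetric] using X Y \<theta> by (intro mult_left_mono) auto
    ultimately show ?thesis by linarith
  qed
  also have "\<theta> / 2 * (\<omega> 1 * f (X 1) + \<omega> 1 * f (X L) + \<omega> 1 * f (Y L))
        - \<mu> * (l (F (Y L)) - l (F (X 1)))
      = \<kappa> * f (X L) + (\<kappa> * f (X 1) + \<mu> * (l (F (X 1)) + g (X 1)))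
        + (\<kappa> * f (Y L) - \<mu> * (l (F (Y L)) + g (Y L)))"
    using g by (simp add: \<kappa>_def algebra_simps)
  finally have "\<kappa> * f (X L) \<le> l (A + \<theta> *\<^sub>R ((1/2) *\<^sub>R (\<Sum>\<nu>=1..L. \<omega> \<nu> *\<^sub>R (X \<nu> + Y \<nu>)) - A)
      - \<mu> *\<^sub>R (F (Y L) - F (X 1))) + c" using 1 2 by linarith
  then show ?thesis using mult_pos_pos[OF \<kappa>(1) fpos[OF G1(2)]] by linarith
qed

text \<open>The real index \<open>r\<close> lets one statement serve both meshes. By
  \<open>admissible_iff\<close> it remains to apply \<open>limited_update_pos\<close> to
  \<open>dens\<close> and to each energy functional; equal \<open>B_1\<close> at both interfaces
  makes the corrections agree.\<close>

lemma cdg_update_admissible: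
  assumes eos: "equation_of_state e h" and cold: "vanishes_at_zero_pressure e"
    and GL: "gauss_lobatto L \<xi> \<omega>" and k: "k \<le> 2 * L - 3"
    and dx: "dx > 0" and dt: "dt > 0"
    and V: "poly_on k (cell x0 dx (r - 1/2)) V" "poly_on k (cell x0 dx (r + 1/2)) V"
    and avg: "cell_avg x0 dx U r \<in> admissible h"
    and nodes: "\<And>\<nu>. \<nu> \<in> {1..L} \<Longrightarrow> node_value x0 dx V (r - 1/4) (\<xi> \<nu>) \<in> admissible h \<and>
        node_value x0 dx V (r + 1/4) (\<xi> \<nu>) \<in> admissible h"
    and div: "mag (V (grid x0 dx (r - 1/2))) $ 1 = mag (V (grid x0 dx (r + 1/2))) $ 1"
    and \<theta>: "0 < dt / \<tau>" "dt / \<tau> \<le> 1" and CFL: "dt \<le> dt / \<tau> * \<omega> 1 / 2 * dx"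
  shows "cell_avg x0 dx U r + dt *\<^sub>R cdg_op h x0 dx \<tau> U V r \<in> admissible h"
proof -
  define A where "A = cell_avg x0 dx U r"
  define X where "X \<nu> = node_value x0 dx V (r - 1/4) (\<xi> \<nu>)" for \<nu>
  define Y where "Y \<nu> = node_value x0 dx V (r + 1/4) (\<xi> \<nu>)" for \<nu>
  define N where "N = A + (dt / \<tau>) *\<^sub>R ((1/2) *\<^sub>R (\<Sum>\<nu>=1..L. \<omega> \<nu> *\<^sub>R (X \<nu> + Y \<nu>)) - A)
      - (dt / dx) *\<^sub>R (flux h 1 (Y L) - flux h 1 (X 1))"
  note nv = cell_avg_nodes[OF GL k dx V, folded X_def Y_def]
  have B1: "mag (X 1) $ 1 = mag (Y L) $ 1" unfolding nv(2,3) by (rule div)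
  have "cell_avg x0 dx U r + dt *\<^sub>R cdg_op h x0 dx \<tau> U V r = N"
    unfolding cdg_op_def nv(1) nv(2,3)[symmetric] N_def A_def[symmetric]
    by (simp add: scaleR_diff_right)
  moreover have "N \<in> admissible h"
  proof -
    have G: "A \<in> admissible h"
      "\<And>\<nu>. \<nu> \<in> {1..L} \<Longrightarrow> X \<nu> \<in> admissible h \<and> Y \<nu> \<in> admissible h"
      using avg nodes by (simp_all add: A_def X_def Y_def)
    have \<mu>: "0 < dt / dx" "dt / dx \<le> dt / \<tau> * \<omega> 1 / 2"
      using dx dt CFL by (simp_all add: pos_divide_le_eq)
    have "linear dens" unfolding dens_def by (rule linear_fst)
    from limited_update_pos[OF this, of "admissible h" 0 "flux h 1" "\<lambda>_. 0", OF _ _ GL G _ \<theta> \<mu>]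
    have "0 < dens N" using admissible_dens by (simp add: N_def)
    moreover have "0 < N \<bullet> normal w C + p_mag w C" if w: "norm w < 1" for w C
    proof -
      have lin: "linear (\<lambda>U. U \<bullet> normal w C)"
        by (rule bounded_linear.linear[OF bounded_linear_inner_left])
      show ?thesis unfolding N_def
      proof (rule limited_update_pos[OF lin, of "admissible h" "p_mag w C" "flux h 1"
            "\<lambda>U. w $ 1 * p_mag w C - mag U $ 1 * (w \<bullet> C)", OF _ _ GL G _ \<theta> \<mu>])
        fix U assume U: "U \<in> admissible h"
        show "0 < U \<bullet> normal w C + p_mag w C" by (rule admissible_energy(1)[OF eos U w])
        fix s :: real assume "\<bar>s\<bar> \<le> 1"
        from admissible_energy(2)[OF eos U w this, of C]
        show "0 \<le> U \<bullet> normal w C + p_mag w C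
            + s * (flux h 1 U \<bullet> normal w C + (w $ 1 * p_mag w C - mag U $ 1 * (w \<bullet> C)))"
          by (simp only: add_diff_eq)
      next
        show "w $ 1 * p_mag w C - mag (X 1) $ 1 * (w \<bullet> C)
            = w $ 1 * p_mag w C - mag (Y L) $ 1 * (w \<bullet> C)"
          by (simp only: B1)
      qed
    qed
    ultimately show ?thesis unfolding admissible_iff[OF eos cold] by blast
  qed
  ultimately show ?thesis by simp
qed

theorem theorem3p2:
  fixes e h :: "real \<Rightarrow> real \<Rightarrow> real"
    and k L :: nat
    and x0 dx dt \<tau>max \<theta> Bconst :: real
    and \<xi> \<omega> :: "nat \<Rightarrow> real"
    and UI UJ :: "real \<Rightarrow> state"
  assumes eos: "equation_of_state e h"
    and cold: "vanishes_at_zero_pressure e"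
    and dx: "dx > 0" and tau: "\<tau>max > 0"
    and L: "L = nat \<lceil>(real k + 3) / 2\<rceil>"
    and GL: "gauss_lobatto L \<xi> \<omega>"
    and polyI: "\<And>j :: int. poly_on k (cell x0 dx j) UI"
    and polyJ: "\<And>j :: int. poly_on k (cell x0 dx (j + 1/2)) UJ"
    and avgI: "\<And>j :: int. cell_avg x0 dx UI j \<in> admissible h"
    and avgJ: "\<And>j :: int. cell_avg x0 dx UJ (j + 1/2) \<in> admissible h"
    and nodesI: "\<And>(j :: int) \<nu>. \<nu> \<in> {1..L} \<Longrightarrow>
                   node_value x0 dx UI (j - 1/4) (\<xi> \<nu>) \<in> admissible h \<and>
                   node_value x0 dx UI (j + 1/4) (\<xi> \<nu>) \<in> admissible h"
    and nodesJ: "\<And>(j :: int) \<nu>. \<nu> \<in> {1..L} \<Longrightarrow>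
                   node_value x0 dx UJ (j - 1/4) (\<xi> \<nu>) \<in> admissible h \<and>
                   node_value x0 dx UJ (j + 1/4) (\<xi> \<nu>) \<in> admissible h"
    and divJ: "\<And>j :: int. mag (UJ (grid x0 dx (j - 1/2))) $ 1 = Bconst \<and>
                           mag (UJ (grid x0 dx (j + 1/2))) $ 1 = Bconst"
    and divI: "\<And>j :: int. mag (UI (grid x0 dx j)) $ 1 = Bconst \<and>
                           mag (UI (grid x0 dx (j + 1))) $ 1 = Bconst"
    and theta: "\<theta> = dt / \<tau>max" "0 < \<theta>" "\<theta> \<le> 1"
    and CFL: "0 < dt" "dt \<le> \<theta> * \<omega> 1 / 2 * dx"
  shows "\<forall>j :: int.
           cell_avg x0 dx UI j + dt *\<^sub>R cdg_op h x0 dx \<tau>max UI UJ j \<in> admissible h \<and>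
           cell_avg x0 dx UJ (j + 1/2) + dt *\<^sub>R cdg_op h x0 dx \<tau>max UJ UI (j + 1/2)
             \<in> admissible h"
proof (intro allI conjI)
  fix j :: int
  \<comment> \<open>The ceiling in \<open>L\<close> is what makes the quadrature exact for degree
    \<open>k\<close>.\<close>
  have k: "k \<le> 2 * L - 3"
  proof -
    have "(real k + 3) / 2 \<le> real L" unfolding L by linarith
    then have "real (k + 3) \<le> real (2 * L)" by simp
    then have "k + 3 \<le> 2 * L" by (simp only: of_nat_le_iff)
    then show ?thesis by simp
  qed
  note \<theta> = theta(2,3)[unfolded theta(1)] and CFL' = CFL(2)[unfolded theta(1)]
  note update = cdg_update_admissible[OF eos cold GL k dx CFL(1) _ _ _ _ _ \<theta> CFL']
  show "cell_avg x0 dx UI j + dt *\<^sub>R cdg_op h x0 dx \<tau>max UI UJ j \<in> admissible h"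
  proof (rule update[OF _ polyJ avgI nodesJ])
    have "real_of_int (j - 1) + 1/2 = real_of_int j - 1/2" by simp
    then show "poly_on k (cell x0 dx (real_of_int j - 1/2)) UJ" using polyJ[of "j - 1"] by simp
    show "mag (UJ (grid x0 dx (real_of_int j - 1/2))) $ 1 = mag (UJ (grid x0 dx (real_of_int j + 1/2))) $ 1"
      using divJ[of j] by simp
  qed
  \<comment> \<open>A dual cell is the right half of primal cell \<open>j\<close> joined to the left
    half of cell \<open>j + 1\<close>, so its quarter points belong to different primal
    cells.\<close>
  have idx: "real_of_int j + 1/2 - 1/2 = real_of_int j" "real_of_int j + 1/2 + 1/2 = real_of_int (j + 1)"
    "real_of_int j + 1/2 - 1/4 = real_of_int j + 1/4" "real_of_int j + 1/2 + 1/4 = real_of_int (j + 1) - 1/4"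
    by simp_all
  show "cell_avg x0 dx UJ (j + 1/2) + dt *\<^sub>R cdg_op h x0 dx \<tau>max UJ UI (j + 1/2) \<in> admissible h"
  proof (rule update[of x0 "real_of_int j + 1/2", unfolded idx])
    show "poly_on k (cell x0 dx (real_of_int j)) UI" by (rule polyI)
    show "poly_on k (cell x0 dx (real_of_int (j + 1))) UI" by (rule polyI)
    show "cell_avg x0 dx UJ (real_of_int j + 1/2) \<in> admissible h" by (rule avgJ)
    show "mag (UI (grid x0 dx (real_of_int j))) $ 1 = mag (UI (grid x0 dx (real_of_int (j + 1)))) $ 1"
      using divI[of j] by simp
    fix \<nu> assume "\<nu> \<in> {1..L}"
    then show "node_value x0 dx UI (real_of_int j + 1/4) (\<xi> \<nu>) \<in> admissible h \<and>
        node_value x0 dx UI (real_of_int (j + 1) - 1/4) (\<xi> \<nu>) \<in> admissible h"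
      using nodesI[of \<nu> j] nodesI[of \<nu> "j + 1"] by blast
  qed
qed

end
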